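(* Let $G$ be the fundamental group of a finite graph of groups $(\mathcal{G},\Gamma)$, in which the underlying graph $\Gamma$ is a tree and each vertex group is finitely generated abelian. Then $G$ has (VRC).
   Context: A subgroup $H$ of a group $G$ is a virtual retract of $G$ if there is a finite index subgroup $K$ of $G$ such that $H \subseteq K$ and there is a homomorphism $\rho: K \to H$ whose restriction to $H$ is the identity map. A group has property (VRC) if every cyclic subgroup is a virtual retract. Graphs are in the sense of Serre: a graph $\Gamma$ has a vertex set $V\Gamma$, an edge set $E\Gamma$, an inversion map $e \mapsto \overline{e}$ on $E\Gamma$ with $\overline{e} \ne e$ and $\overline{\overline{e}} = e$, and incidence maps $\alpha,\omega: E\Gamma \to V\Gamma$ with $\omega(\overline{e}) = \alpha(e)$. An orientation is a decomposition $E\Gamma = E\Gamma^+ \sqcup E\Gamma^-$ with $E\Gamma^- = \{\overline{e} \mid e \in E\Gamma^+\}$. A finite graph of groups $(\mathcal{G},\Gamma)$ consists of a non-empty finite connected graph $\Gamma$, vertex groups $G_v$ ($v \in V\Gamma$), edge groups $G_e$ ($e \in E\Gamma$) with $G_e = G_{\overline{e}}$, and monomorphisms $\alpha_e: G_e \to G_{\alpha(e)}$ ($e \in E\Gamma$); put $\omega_e := \alpha_{\overline{e}}: G_e \to G_{\omega(e)}$. Given a maximal tree $T$ in $\Gamma$ and an orientation, its fundamental group is the group generated by all $G_v$, $v \in V\Gamma$, and free letters $t_e$, $e \in E\Gamma^+$, subject to the relations of the vertex groups, $t_e\, \omega_e(a)\, t_e^{-1} = \alpha_e(a)$ for all $e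 \in E\Gamma^+$, $a \in G_e$, and $t_f = 1$ for all $f \in ET \cap E\Gamma^+$; up to isomorphism it does not depend on the choices. (If $\Gamma$ is a tree then $T = \Gamma$, and $G$ is generated by the vertex groups subject to $\omega_e(a) = \alpha_e(a)$.) *)

theory Defs
  imports "HOL-Algebra.Elementary_Groups" "Graph_Theory.Graph_Theory"
begin

section \<open>Virtual retracts and property (VRC)\<close>

definition virtual_retract :: "('a, 'm) monoid_scheme \<Rightarrow> 'a set \<Rightarrow> bool" where
  "virtual_retract G H \<longleftrightarrow> subgroup H G \<and>
     (\<exists>K. subgroup K G \<and> finite (rcosets\<^bsub>G\<^esub> K) \<and> H \<subseteq> K \<and>
        (\<exists>\<rho> \<in> hom (G\<lparr>carrier := K\<rparr>) (G\<lparr>carrier := H\<rparr>). \<forall>h\<in>H. \<rho> h = h))"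

definition has_VRC :: "('a, 'm) monoid_scheme \<Rightarrow> bool" where
  "has_VRC G \<longleftrightarrow>
     (\<forall>H. subgroup H G \<and> cyclic_group (G\<lparr>carrier := H\<rparr>) \<longrightarrow> virtual_retract G H)"

definition finitely_generated_group :: "('a, 'm) monoid_scheme \<Rightarrow> bool" where
  "finitely_generated_group G \<longleftrightarrow>
     group G \<and> (\<exists>S. finite S \<and> S \<subseteq> carrier G \<and> generate G S = carrier G)"


section \<open>Groups given by generators and relations\<close>

text \<open>The letter \<open>(x, True)\<close> stands for the generator \<open>x\<close>, and \<open>(x, False)\<close> for its
  formal inverse. Each pair \<open>(u, w)\<close> in the set \<open>R\<close> is a defining relation \<open>u = w\<close>;
  pairs that are not words over the generating set are ignored.\<close>

type_synonym 'x gword = "('x \<times> bool) list"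

definition gwords :: "'x set \<Rightarrow> 'x gword set" where
  "gwords X = lists (X \<times> UNIV)"

inductive_set pres_rel :: "'x set \<Rightarrow> ('x gword \<times> 'x gword) set \<Rightarrow> ('x gword \<times> 'x gword) set"
  for X :: "'x set" and R :: "('x gword \<times> 'x gword) set" where
  refl: "w \<in> gwords X \<Longrightarrow> (w, w) \<in> pres_rel X R"
| sym: "(u, w) \<in> pres_rel X R \<Longrightarrow> (w, u) \<in> pres_rel X R"
| trans: "(u, v) \<in> pres_rel X R \<Longrightarrow> (v, w) \<in> pres_rel X R \<Longrightarrow> (u, w) \<in> pres_rel X R"
| append: "(u, u') \<in> pres_rel X R \<Longrightarrow> (w, w') \<in> pres_rel X R \<Longrightarrow> (u @ w, u' @ w') \<in> pres_rel X R"
| cancel: "x \<in> X \<Longrightarrow> ([(x, b), (x, \<not> b)], []) \<in> pres_rel X R"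
| relation: "(u, w) \<in> R \<Longrightarrow> u \<in> gwords X \<Longrightarrow> w \<in> gwords X \<Longrightarrow> (u, w) \<in> pres_rel X R"

definition presented_group :: "'x set \<Rightarrow> ('x gword \<times> 'x gword) set \<Rightarrow> 'x gword set monoid" where
  "presented_group X R =
     \<lparr>carrier = gwords X // pres_rel X R,
      monoid.mult = (\<lambda>A B. \<Union>u\<in>A. \<Union>w\<in>B. pres_rel X R `` {u @ w}),
      one = pres_rel X R `` {[]}\<rparr>"

lemma pres_rel_gwords: "(u, w) \<in> pres_rel X R \<Longrightarrow> u \<in> gwords X \<and> w \<in> gwords X"
  by (induction rule: pres_rel.induct) (auto simp: gwords_def)

lemma equiv_pres_rel: "equiv (gwords X) (pres_rel X R)"
proof (rule equivI)
  show "pres_rel X R \<subseteq> gwords X \<times> gwords X" using pres_rel_gwords by fast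
  show "refl_on (gwords X) (pres_rel X R)"
    by (auto simp: refl_on_def intro: pres_rel.refl)
  show "sym (pres_rel X R)" by (rule symI) (rule pres_rel.sym)
  show "trans (pres_rel X R)" by (rule transI) (rule pres_rel.trans)
qed

lemma presented_group_mult:
  assumes "u \<in> gwords X" "w \<in> gwords X"
  shows "(pres_rel X R `` {u}) \<otimes>\<^bsub>presented_group X R\<^esub> (pres_rel X R `` {w}) = pres_rel X R `` {u @ w}"
proof -
  have "congruent2 (pres_rel X R) (pres_rel X R) (\<lambda>u w. pres_rel X R `` {u @ w})"
    by (rule congruent2I') (intro equiv_class_eq[OF equiv_pres_rel] pres_rel.append)
  then show ?thesis
    using UN_equiv_class2[OF equiv_pres_rel equiv_pres_rel _ assms]
    by (simp add: presented_group_def)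
qed

lemma group_presented_group: "group (presented_group X R)"
proof -
  let ?r = "pres_rel X R" and ?G = "presented_group X R"
  have car: "carrier ?G = gwords X // ?r" and one: "\<one>\<^bsub>?G\<^esub> = ?r `` {[]}"
    by (simp_all add: presented_group_def)
  have app: "u @ w \<in> gwords X" if "u \<in> gwords X" "w \<in> gwords X" for u w
    using that by (simp add: gwords_def)
  have nil: "[] \<in> gwords X" by (simp add: gwords_def)
  have inv: "\<exists>u \<in> gwords X. (u @ w, []) \<in> ?r" if "w \<in> gwords X" for w
    using that unfolding gwords_def
  proof (induction w rule: lists.induct)
    case Nil
    show ?case using pres_rel.refl[OF nil] by (auto simp: gwords_def)
  next
    case (Cons l w)
    obtain x b where l: "l = (x, b)" "x \<in> X" using Cons.hyps(1) by auto
    obtain u where u: "u \<in> lists (X \<times> UNIV)" "(u @ w, []) \<in> ?r" using Cons.IH by auto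
    have ru: "(u, u) \<in> ?r" and rw: "(w, w) \<in> ?r"
      using u Cons.hyps by (auto intro!: pres_rel.refl simp: gwords_def)
    have "([(x, \<not> b), (x, b)], []) \<in> ?r"
      using pres_rel.cancel[OF l(2), of "\<not> b" R] by simp
    then have "(u @ ([(x, \<not> b), (x, b)] @ w), u @ ([] @ w)) \<in> ?r"
      by (intro pres_rel.append ru rw)
    then have "((u @ [(x, \<not> b)]) @ l # w, []) \<in> ?r"
      using pres_rel.trans u(2) l by simp
    moreover have "u @ [(x, \<not> b)] \<in> lists (X \<times> UNIV)" using u l by auto
    ultimately show ?case by blast
  qed
  show ?thesis
  proof (rule groupI)
    show "\<one>\<^bsub>?G\<^esub> \<in> carrier ?G" using nil by (auto simp: car one intro: quotientI)
  next
    fix a b assume "a \<in> carrier ?G" "b \<in> carrier ?G"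
    then show "a \<otimes>\<^bsub>?G\<^esub> b \<in> carrier ?G"
      by (auto simp: car elim!: quotientE simp: presented_group_mult app intro!: quotientI)
  next
    fix a b c assume "a \<in> carrier ?G" "b \<in> carrier ?G" "c \<in> carrier ?G"
    then show "a \<otimes>\<^bsub>?G\<^esub> b \<otimes>\<^bsub>?G\<^esub> c = a \<otimes>\<^bsub>?G\<^esub> (b \<otimes>\<^bsub>?G\<^esub> c)"
      by (auto simp: car elim!: quotientE simp: presented_group_mult app)
  next
    fix a assume "a \<in> carrier ?G"
    then show "\<one>\<^bsub>?G\<^esub> \<otimes>\<^bsub>?G\<^esub> a = a"
      by (auto simp: car one elim!: quotientE simp: presented_group_mult nil)
  next
    fix a assume "a \<in> carrier ?G"
    then obtain w where w: "w \<in> gwords X" "a = ?r `` {w}" by (auto simp: car elim: quotientE)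
    obtain u where u: "u \<in> gwords X" "(u @ w, []) \<in> ?r" using inv[OF w(1)] by blast
    then have "?r `` {u} \<otimes>\<^bsub>?G\<^esub> a = \<one>\<^bsub>?G\<^esub>"
      by (simp add: w presented_group_mult one equiv_class_eq[OF equiv_pres_rel])
    moreover have "?r `` {u} \<in> carrier ?G" using u by (auto simp: car intro: quotientI)
    ultimately show "\<exists>b\<in>carrier ?G. b \<otimes>\<^bsub>?G\<^esub> a = \<one>\<^bsub>?G\<^esub>" by blast
  qed
qed


section \<open>Trees and orientations in Serre's graphs\<close>

text \<open>A graph in the sense of Serre is a \<^locale>\<open>bidirected_digraph\<close>: \<open>tail\<close> and \<open>head\<close>
  are the incidence maps \<open>\<alpha>\<close> and \<open>\<omega>\<close>, and \<open>arev\<close> is the inversion of edges, which the locale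
  extends by the identity outside the edge set. In such a graph the library's
  \<^const>\<open>pre_digraph.cycle\<close> also admits the backtracking walk \<open>e, arev e\<close>, so a circuit is a
  cycle without backtracking, and the library's \<open>tree\<close> is not the right notion.\<close>

definition serre_circuit :: "('v, 'e) pre_digraph \<Rightarrow> ('e \<Rightarrow> 'e) \<Rightarrow> 'e list \<Rightarrow> bool" where
  "serre_circuit G arev p \<longleftrightarrow>
     pre_digraph.cycle G p \<and> successively (\<lambda>e f. f \<noteq> arev e) p"

definition serre_tree :: "('v, 'e) pre_digraph \<Rightarrow> ('e \<Rightarrow> 'e) \<Rightarrow> bool" where
  "serre_tree G arev \<longleftrightarrow>
     arev ` arcs G \<subseteq> arcs G \<and> Digraph_Component.connected G \<and> (\<nexists>p. serre_circuit G arev p)"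

definition maximal_tree ::
  "('v, 'e) pre_digraph \<Rightarrow> ('e \<Rightarrow> 'e) \<Rightarrow> ('v, 'e) pre_digraph \<Rightarrow> bool" where
  "maximal_tree G arev T \<longleftrightarrow> pre_digraph.max_subgraph G (\<lambda>H. serre_tree H arev) T"

definition orientation :: "('v, 'e) pre_digraph \<Rightarrow> ('e \<Rightarrow> 'e) \<Rightarrow> 'e set \<Rightarrow> bool" where
  "orientation G arev P \<longleftrightarrow> P \<inter> arev ` P = {} \<and> P \<union> arev ` P = arcs G"


section \<open>Graphs of groups and their fundamental groups\<close>

locale finite_graph_of_groups = bidirected_digraph \<Gamma> arev + fin_digraph \<Gamma>
  for \<Gamma> :: "('v, 'e) pre_digraph" and arev :: "'e \<Rightarrow> 'e" +
  fixes vgrp :: "'v \<Rightarrow> 'g monoid"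
    and egrp :: "'e \<Rightarrow> 'h monoid"
    and \<alpha> :: "'e \<Rightarrow> 'h \<Rightarrow> 'g"
  assumes connected: "Digraph_Component.connected \<Gamma>"
    and group_vgrp: "v \<in> verts \<Gamma> \<Longrightarrow> group (vgrp v)"
    and group_egrp: "e \<in> arcs \<Gamma> \<Longrightarrow> group (egrp e)"
    and egrp_arev: "e \<in> arcs \<Gamma> \<Longrightarrow> egrp (arev e) = egrp e"
    and mon_\<alpha>: "e \<in> arcs \<Gamma> \<Longrightarrow> \<alpha> e \<in> mon (egrp e) (vgrp (tail \<Gamma> e))"

datatype ('v, 'g, 'e) gog_gen = Vertex_Elt 'v 'g | Stable 'e

definition fg_gens ::
  "('v, 'e) pre_digraph \<Rightarrow> ('v \<Rightarrow> 'g monoid) \<Rightarrow> 'e set \<Rightarrow> ('v, 'g, 'e) gog_gen set" where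
  "fg_gens \<Gamma> vgrp P =
     {Vertex_Elt v g | v g. v \<in> verts \<Gamma> \<and> g \<in> carrier (vgrp v)} \<union> Stable ` P"

text \<open>The three sets are the multiplication tables of the vertex groups, the relations
  \<open>t\<^sub>e \<omega>\<^sub>e(a) t\<^sub>e\<inverse> = \<alpha>\<^sub>e(a)\<close> with \<open>\<omega>\<^sub>e = \<alpha> (arev e)\<close>, and \<open>t\<^sub>f = 1\<close> for edges \<open>f\<close> of the tree.\<close>

definition fg_rels ::
  "('v, 'e) pre_digraph \<Rightarrow> ('e \<Rightarrow> 'e) \<Rightarrow> ('v \<Rightarrow> 'g monoid) \<Rightarrow> ('e \<Rightarrow> 'h monoid) \<Rightarrow> ('e \<Rightarrow> 'h \<Rightarrow> 'g) \<Rightarrow>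
   ('v, 'e) pre_digraph \<Rightarrow> 'e set \<Rightarrow> (('v, 'g, 'e) gog_gen gword \<times> ('v, 'g, 'e) gog_gen gword) set" where
  "fg_rels \<Gamma> arev vgrp egrp \<alpha> T P =
     {([(Vertex_Elt v g, True), (Vertex_Elt v h, True)], [(Vertex_Elt v (g \<otimes>\<^bsub>vgrp v\<^esub> h), True)])
       | v g h. v \<in> verts \<Gamma> \<and> g \<in> carrier (vgrp v) \<and> h \<in> carrier (vgrp v)} \<union>
     {([(Stable e, True), (Vertex_Elt (head \<Gamma> e) (\<alpha> (arev e) a), True), (Stable e, False)],
       [(Vertex_Elt (tail \<Gamma> e) (\<alpha> e a), True)])
       | e a. e \<in> P \<and> a \<in> carrier (egrp e)} \<union>
     {([(Stable f, True)], []) | f. f \<in> arcs T \<inter> P}"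

definition fundamental_group ::
  "('v, 'e) pre_digraph \<Rightarrow> ('e \<Rightarrow> 'e) \<Rightarrow> ('v \<Rightarrow> 'g monoid) \<Rightarrow> ('e \<Rightarrow> 'h monoid) \<Rightarrow> ('e \<Rightarrow> 'h \<Rightarrow> 'g) \<Rightarrow>
   ('v, 'e) pre_digraph \<Rightarrow> 'e set \<Rightarrow> ('v, 'g, 'e) gog_gen gword set monoid" where
  "fundamental_group \<Gamma> arev vgrp egrp \<alpha> T P =
     presented_group (fg_gens \<Gamma> vgrp P) (fg_rels \<Gamma> arev vgrp egrp \<alpha> T P)"

lemma group_fundamental_group: "group (fundamental_group \<Gamma> arev vgrp egrp \<alpha> T P)"
  unfolding fundamental_group_def by (rule group_presented_group)

end

theory Submission
  imports Defs "HOL-Algebra.Multiplicative_Group" "HOL-Library.Function_Algebras"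
begin

text \<open>Characters of a vertex group with values in a root-closed group of complex numbers extend
  over the whole tree, one edge after the other. So a conjugate \<open>g\<close> of a vertex element is mapped
  by some character of the fundamental group to a number \<open>h\<close> of the same order as \<open>g\<close>, every value
  of the character having a power in \<open>\<langle>h\<rangle>\<close>; as the group is finitely generated, the preimage of
  \<open>\<langle>h\<rangle>\<close> has finite index, and it retracts onto \<open>\<langle>g\<rangle>\<close>.

  Any other \<open>g\<close> is conjugate to the value of a cyclically reduced closed walk of some length \<open>n > 0\<close>.
  Finitely many characters of finite order separate the vertex elements at its backtrackings from the
  edge groups; let \<open>R\<close> be the finite abelian image of their product. In the style of Marshall Hall's
  theorem, the walk is spread out along \<open>R \<times> \<int>\<close>: each arc \<open>e\<close> gets an involution that swaps
  the orbits of the edge group through which the walk passes at consecutive levels. Conjugating the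
  actions of the vertex groups on \<open>R \<times> \<int>\<close> by products of these involutions makes them agree on
  edge groups, so they define an action of the fundamental group that commutes with the shift by
  \<open>2n\<close> levels. In it \<open>g\<close> shifts some point by exactly \<open>2n\<close> levels, and the stabilizer of the
  shift orbit of that point has finite index and retracts onto \<open>\<langle>g\<rangle>\<close>.\<close>

section \<open>Serre trees\<close>

context bidirected_digraph
begin

lemma symmetric_bidirected: "symmetric G"
  unfolding symmetric_conv by (metis arev_in_arcs head_arev tail_arev)

lemma connected_reachable:
  assumes "Digraph_Component.connected G" "u \<in> verts G" "v \<in> verts G"
  shows "u \<rightarrow>\<^sup>*\<^bsub>G\<^esub> v"
  using assms reachable_mk_symmetric_eq[OF symmetric_bidirected]
  unfolding Digraph_Component.connected_def strongly_connected_def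
  by (auto simp: mk_symmetric_def)

lemma connected_exit_arc:
  assumes "Digraph_Component.connected G" "r \<in> S" "S \<subset> verts G"
  obtains e where "e \<in> arcs G" "tail G e \<in> S" "head G e \<notin> S"
proof -
  obtain v where v: "v \<in> verts G" "v \<notin> S" using assms(3) by blast
  have "r \<rightarrow>\<^sup>*\<^bsub>G\<^esub> v" using connected_reachable[OF assms(1) _ v(1)] assms by blast
  then have "v \<in> S \<or> (\<exists>e\<in>arcs G. tail G e \<in> S \<and> head G e \<notin> S)"
  proof (induction rule: reachable_induct)
    case base then show ?case using assms by simp
  next
    case (step x y) then show ?case by (auto simp: arcs_ends_conv)
  qed
  then show ?thesis using v that by blast
qed

lemma serre_tree_no_circuit:
  assumes "serre_tree G arev" "awalk u p u" "p \<noteq> []" "distinct (tl (awalk_verts u p))"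
    "successively (\<lambda>e f. f \<noteq> arev e) p"
  shows False
  using assms unfolding serre_tree_def serre_circuit_def cycle_def by blast

text \<open>A backtracking pair \<open>e\<close>, \<open>arev e\<close> would return to the tail of
  \<open>e\<close>, which a simple path visits only once.\<close>

lemma apath_no_backtrack:
  assumes "apath u p v" shows "successively (\<lambda>e f. f \<noteq> arev e) p"
  using assms
proof (induction p arbitrary: u)
  case (Cons e p)
  have p: "e \<in> arcs G" "apath (head G e) p v" "tail G e \<notin> set (awalk_verts (head G e) p)"
    using Cons.prems by (auto simp: apath_Cons_iff)
  show ?case
  proof (cases p)
    case (Cons f q)
    have "head G f \<noteq> tail G e" using p(2,3) Cons by (cases q) (auto simp: apath_Cons_iff)
    then have "f \<noteq> arev e" using p(1) by auto
    then show ?thesis using Cons.IH[OF p(2)] Cons by simp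
  qed simp
qed simp

lemma serre_tree_no_loop:
  assumes "serre_tree G arev" "e \<in> arcs G" shows "tail G e \<noteq> head G e"
  using serre_tree_no_circuit[OF assms(1), of "tail G e" "[e]"] assms(2)
  by (auto simp: awalk_simps)

text \<open>Two different arcs from a connected set to the same outside vertex would close up to a circuit.\<close>

lemma serre_tree_unique_arc:
  assumes tree: "serre_tree G arev"
    and conn: "\<And>u v. u \<in> S \<Longrightarrow> v \<in> S \<Longrightarrow> \<exists>p. apath u p v \<and> set (awalk_verts u p) \<subseteq> S"
    and e: "e \<in> arcs G" "tail G e \<in> S" "head G e \<notin> S"
    and f: "f \<in> arcs G" "tail G f \<in> S" "head G f = head G e"
  shows "f = e"
proof (rule ccontr)
  assume ne: "f \<noteq> e"
  obtain p where p: "apath (tail G f) p (tail G e)" "set (awalk_verts (tail G f) p) \<subseteq> S"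
    using conn[OF f(2) e(2)] by blast
  let ?q = "p @ [e, arev f]"
  have w: "awalk (tail G f) p (tail G e)" using p(1) by (simp add: apath_def)
  then have last: "awlast (tail G f) p = tail G e" by auto
  have aw: "awalk (tail G f) ?q (tail G f)"
    using w last e f by (simp add: awalk_simps)
  have "awalk_verts (tail G f) ?q = awalk_verts (tail G f) p @ [head G e, tail G f]"
    using awalk_verts_append[OF aw] last f by simp
  moreover have "tail G f = hd (awalk_verts (tail G f) p)" using w by auto
  moreover have "distinct (awalk_verts (tail G f) p)" using p(1) by (simp add: apath_def)
  ultimately have d: "distinct (tl (awalk_verts (tail G f) ?q))"
    using p(2) e(3) f(2) by (cases "awalk_verts (tail G f) p") auto
  \<comment> \<open>The vertices of \<open>p\<close> lie in \<open>S\<close> and the head of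
    \<open>e\<close> does not. Together with \<open>f \<noteq> e\<close> this excludes backtracking
    at the two junctions of \<open>?q\<close>.\<close>
  have "last p \<noteq> arev e" if "p \<noteq> []"
  proof
    assume "last p = arev e"
    then have "tail G (last p) = head G e" using e by simp
    moreover have "tail G (last p) \<in> set (awalk_verts (tail G f) p)"
      using that by (intro awalk_verts_arc1) simp
    ultimately show False using p(2) e(3) by auto
  qed
  then have "successively (\<lambda>e f. f \<noteq> arev e) ?q"
    using apath_no_backtrack[OF p(1)] ne arev_eq_iff arev_arev
    by (auto simp: successively_append_iff)
  then show False using serre_tree_no_circuit[OF tree aw _ d] by simp
qed

text \<open>The data are chosen vertex by vertex, starting at \<open>r\<close>. A new vertex hangs
  on the part already treated by a single arc, so one application of \<open>step\<close> meets every
  new constraint and \<open>sym\<close> takes care of the reverse arc. It is applied below to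
  characters and to conjugating permutations.\<close>

lemma serre_tree_family:
  fixes R :: "'b \<Rightarrow> 'x \<Rightarrow> 'x \<Rightarrow> bool" and Q :: "'a \<Rightarrow> 'x \<Rightarrow> bool"
  assumes tree: "serre_tree G arev" and fin: "finite (verts G)"
    and r: "r \<in> verts G" "Q r x\<^sub>0"
    and sym: "\<And>e x y. e \<in> arcs G \<Longrightarrow> R e x y \<Longrightarrow> R (arev e) y x"
    and step: "\<And>e x. e \<in> arcs G \<Longrightarrow> Q (tail G e) x \<Longrightarrow> \<exists>y. Q (head G e) y \<and> R e x y"
  obtains f where "f r = x\<^sub>0" "\<And>v. v \<in> verts G \<Longrightarrow> Q v (f v)"
    "\<And>e. e \<in> arcs G \<Longrightarrow> R e (f (tail G e)) (f (head G e))"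
proof -
  have conG: "Digraph_Component.connected G" using tree by (simp add: serre_tree_def)
  \<comment> \<open>Connectivity is carried along because \<open>serre_tree_unique_arc\<close> asks
    for paths that stay inside \<open>S\<close>. A maximal domain \<open>S\<close> of a partial
    family is then shown to be everything.\<close>
  define conn where "conn S \<longleftrightarrow>
    (\<forall>u\<in>S. \<forall>v\<in>S. \<exists>p. apath u p v \<and> set (awalk_verts u p) \<subseteq> S)" for S
  define fam where "fam S f \<longleftrightarrow> f r = x\<^sub>0 \<and> (\<forall>v\<in>S. Q v (f v)) \<and>
    (\<forall>e\<in>arcs G. tail G e \<in> S \<and> head G e \<in> S \<longrightarrow> R e (f (tail G e)) (f (head G e)))" for S f
  define good where "good S \<longleftrightarrow> r \<in> S \<and> S \<subseteq> verts G \<and> conn S \<and> (\<exists>f. fam S f)" for S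
  have "good {r}"
    using r serre_tree_no_loop[OF tree]
    by (auto simp: good_def conn_def fam_def apath_Nil_iff intro!: exI[of _ "[]"] exI[of _ "\<lambda>_. x\<^sub>0"]) metis+
  moreover have "finite {S. good S}"
    by (rule finite_subset[of _ "Pow (verts G)"]) (auto simp: good_def fin)
  ultimately obtain S where S: "good S" and max: "\<And>S'. good S' \<Longrightarrow> S \<subseteq> S' \<Longrightarrow> S = S'"
    using finite_has_maximal[of "{S. good S}"] by blast
  obtain f where f: "fam S f" and rS: "r \<in> S" and SV: "S \<subseteq> verts G" and con: "conn S"
    using S by (auto simp: good_def)
  have "S = verts G"
  proof (rule ccontr)
    assume "S \<noteq> verts G"
    then obtain e where e: "e \<in> arcs G" "tail G e \<in> S" "head G e \<notin> S"
      using connected_exit_arc[OF conG rS] SV by blast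
    let ?u = "tail G e" and ?w = "head G e"
    obtain y where y: "Q ?w y" "R e (f ?u) y" using step[OF e(1), of "f ?u"] f e(2) by (auto simp: fam_def)
    let ?S = "insert ?w S" and ?f = "f(?w := y)"
    have "conn ?S"
      unfolding conn_def
    proof (intro ballI)
      fix u v assume uv: "u \<in> ?S" "v \<in> ?S"
      have *: "\<exists>p. apath x p ?w \<and> set (awalk_verts x p) \<subseteq> ?S" if "x \<in> S" for x
      proof -
        obtain p where p: "apath x p ?u" "set (awalk_verts x p) \<subseteq> S"
          using con \<open>x \<in> S\<close> e(2) unfolding conn_def by blast
        then have l: "awlast x p = ?u" by (auto simp: apath_def)
        have "apath x (p @ [e]) ?w"
          using p e l by (auto simp: apath_append_iff apath_simps)
        moreover have "set (awalk_verts x (p @ [e])) \<subseteq> ?S"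
          using calculation p l by (auto simp: apath_def awalk_verts_append)
        ultimately show ?thesis by blast
      qed
      have **: "\<exists>p. apath ?w p x \<and> set (awalk_verts ?w p) \<subseteq> ?S" if "x \<in> S" for x
      proof -
        obtain p where p: "apath ?u p x" "set (awalk_verts ?u p) \<subseteq> S"
          using con \<open>x \<in> S\<close> e(2) unfolding conn_def by blast
        have "apath ?w (arev e # p) x" using p e by (auto simp: apath_Cons_iff)
        moreover have "set (awalk_verts ?w (arev e # p)) \<subseteq> ?S" using p e by auto
        ultimately show ?thesis by blast
      qed
      have "\<exists>p. apath ?w p ?w \<and> set (awalk_verts ?w p) \<subseteq> ?S"
        using e by (intro exI[of _ "[]"]) (auto simp: apath_Nil_iff)
      moreover have "\<exists>p. apath u p v \<and> set (awalk_verts u p) \<subseteq> ?S" if "u \<in> S" "v \<in> S"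
        using con that unfolding conn_def by blast
      ultimately show "\<exists>p. apath u p v \<and> set (awalk_verts u p) \<subseteq> ?S"
        using * ** uv by blast
    qed
    moreover have "fam ?S ?f"
      unfolding fam_def
    proof (intro conjI ballI impI)
      show "?f r = x\<^sub>0" using f e(3) rS by (auto simp: fam_def)
      show "Q v (?f v)" if "v \<in> ?S" for v using that f y by (auto simp: fam_def)
      fix g assume g: "g \<in> arcs G" "tail G g \<in> ?S \<and> head G g \<in> ?S"
      \<comment> \<open>Only \<open>e\<close> and \<open>arev e\<close> join \<open>S\<close> to the
        new vertex, and a tree has no loops, so these are the only arcs on which \<open>R\<close> is
        new.\<close>
      have uniq: "h = e" if "h \<in> arcs G" "tail G h \<in> S" "head G h = ?w" for h
        using serre_tree_unique_arc[OF tree _ e that] con by (auto simp: conn_def)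
      show "R g (?f (tail G g)) (?f (head G g))"
      proof (cases "head G g = ?w")
        case True
        then have "tail G g \<in> S" using g serre_tree_no_loop[OF tree g(1)] by auto
        then show ?thesis using uniq[OF g(1) _ True] y e by auto
      next
        case hd: False
        show ?thesis
        proof (cases "tail G g = ?w")
          case True
          then have "arev g = e" using uniq[of "arev g"] g hd by auto
          then have "g = arev e" using arev_arev by metis
          then show ?thesis using sym[OF e(1) y(2)] e by auto
        next
          case False
          then show ?thesis using f g hd by (auto simp: fam_def)
        qed
      qed
    qed
    ultimately have "good ?S" using rS SV e(1) by (auto simp: good_def)
    then show False using max[of ?S] e(3) by blast
  qed
  then show ?thesis using that f by (auto simp: fam_def)
qed

end

section \<open>Homomorphisms out of a presented group\<close>

definition word_eval :: "('l, 'm) monoid_scheme \<Rightarrow> ('x \<Rightarrow> 'l) \<Rightarrow> 'x gword \<Rightarrow> 'l" where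
  "word_eval L \<phi> w = foldr (\<lambda>(x, b) z. (if b then \<phi> x else inv\<^bsub>L\<^esub> \<phi> x) \<otimes>\<^bsub>L\<^esub> z) w \<one>\<^bsub>L\<^esub>"

lemma word_eval_simps [simp]:
  "word_eval L \<phi> [] = \<one>\<^bsub>L\<^esub>"
  "word_eval L \<phi> ((x, b) # w) = (if b then \<phi> x else inv\<^bsub>L\<^esub> \<phi> x) \<otimes>\<^bsub>L\<^esub> word_eval L \<phi> w"
  by (simp_all add: word_eval_def)

lemma gwords_simps [simp]:
  "[] \<in> gwords X" "(l # w) \<in> gwords X \<longleftrightarrow> fst l \<in> X \<and> w \<in> gwords X"
  "(u @ w) \<in> gwords X \<longleftrightarrow> u \<in> gwords X \<and> w \<in> gwords X"
  by (auto simp: gwords_def mem_Times_iff)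

context group
begin

lemma word_eval_closed:
  assumes "\<phi> \<in> X \<rightarrow> carrier G" "w \<in> gwords X"
  shows "word_eval G \<phi> w \<in> carrier G"
  using assms(2) by (induction w) (use assms(1) in \<open>auto simp: Pi_iff\<close>)

lemma word_eval_append:
  assumes "\<phi> \<in> X \<rightarrow> carrier G" "u \<in> gwords X" "w \<in> gwords X"
  shows "word_eval G \<phi> (u @ w) = word_eval G \<phi> u \<otimes> word_eval G \<phi> w"
  using assms(2)
proof (induction u)
  case Nil then show ?case using word_eval_closed[OF assms(1,3)] by simp
next
  case (Cons l u)
  then show ?case using word_eval_closed[OF assms(1,3)] word_eval_closed[OF assms(1), of u] assms(1)
    by (cases l) (auto simp: m_assoc Pi_iff)
qed

lemma word_eval_pres_rel:
  assumes "\<phi> \<in> X \<rightarrow> carrier G"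
    and "\<And>u w. (u, w) \<in> R \<Longrightarrow> u \<in> gwords X \<Longrightarrow> w \<in> gwords X \<Longrightarrow> word_eval G \<phi> u = word_eval G \<phi> w"
    and "(u, w) \<in> pres_rel X R"
  shows "word_eval G \<phi> u = word_eval G \<phi> w"
  using assms(3)
proof (induction rule: pres_rel.induct)
  case (append u u' w w')
  then show ?case
    using pres_rel_gwords[of u u'] pres_rel_gwords[of w w'] word_eval_append[OF assms(1)] by metis
next
  case (cancel x b)
  then show ?case using assms(1) by (cases b) (auto simp: Pi_iff)
qed (use assms(2) in auto)

end

lemma presented_group_hom:
  assumes "group L" "\<phi> \<in> X \<rightarrow> carrier L"
    and "\<And>u w. (u, w) \<in> R \<Longrightarrow> u \<in> gwords X \<Longrightarrow> w \<in> gwords X \<Longrightarrow> word_eval L \<phi> u = word_eval L \<phi> w"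
  obtains \<Phi> where "\<Phi> \<in> hom (presented_group X R) L"
    "\<And>w. w \<in> gwords X \<Longrightarrow> \<Phi> (pres_rel X R `` {w}) = word_eval L \<phi> w"
proof -
  interpret L: group L by fact
  \<comment> \<open>\<open>word_eval_pres_rel\<close> makes the value independent of the
    representative that \<open>SOME\<close> picks.\<close>
  define \<Phi> where "\<Phi> A = word_eval L \<phi> (SOME w. w \<in> A)" for A
  have \<Phi>: "\<Phi> (pres_rel X R `` {w}) = word_eval L \<phi> w" if "w \<in> gwords X" for w
  proof -
    have "w \<in> pres_rel X R `` {w}" using that by (auto intro: pres_rel.refl)
    then have "(SOME u. u \<in> pres_rel X R `` {w}) \<in> pres_rel X R `` {w}" by (rule someI)
    then show ?thesis unfolding \<Phi>_def
      using L.word_eval_pres_rel[OF assms(2,3)] by auto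
  qed
  moreover have "\<Phi> \<in> hom (presented_group X R) L"
  proof (rule homI)
    fix A assume "A \<in> carrier (presented_group X R)"
    then show "\<Phi> A \<in> carrier L"
      using L.word_eval_closed[OF assms(2)]
      by (auto simp: presented_group_def \<Phi> elim!: quotientE)
  next
    fix A B assume "A \<in> carrier (presented_group X R)" "B \<in> carrier (presented_group X R)"
    then show "\<Phi> (A \<otimes>\<^bsub>presented_group X R\<^esub> B) = \<Phi> A \<otimes>\<^bsub>L\<^esub> \<Phi> B"
      using presented_group_mult[of _ X _ R] L.word_eval_append[OF assms(2)]
      by (auto simp: presented_group_def \<Phi> elim!: quotientE)
  qed
  ultimately show ?thesis using that by blast
qed

section \<open>Trees of abelian groups\<close>

text \<open>The maximal tree of a tree is the tree itself, so \<open>\<Gamma>\<close> stands in its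
  place in \<open>PI\<close> below.\<close>

locale abelian_tree = finite_graph_of_groups \<Gamma> arev vgrp egrp \<alpha>
  for \<Gamma> :: "('v, 'e) pre_digraph" and arev :: "'e \<Rightarrow> 'e"
    and vgrp :: "'v \<Rightarrow> 'g monoid" and egrp :: "'e \<Rightarrow> 'h monoid" and \<alpha> :: "'e \<Rightarrow> 'h \<Rightarrow> 'g" +
  fixes P :: "'e set"
  assumes tree: "serre_tree \<Gamma> arev"
    and comm_vgrp: "v \<in> verts \<Gamma> \<Longrightarrow> comm_group (vgrp v)"
    and fin_gen_vgrp: "v \<in> verts \<Gamma> \<Longrightarrow> finitely_generated_group (vgrp v)"
    and orientation: "orientation \<Gamma> arev P"
begin

abbreviation "PI \<equiv> fundamental_group \<Gamma> arev vgrp egrp \<alpha> \<Gamma> P"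

abbreviation "gens \<equiv> fg_gens \<Gamma> vgrp P"
abbreviation "rels \<equiv> fg_rels \<Gamma> arev vgrp egrp \<alpha> \<Gamma> P"
abbreviation "cls w \<equiv> pres_rel gens rels `` {w}"

sublocale PI: group PI by (rule group_fundamental_group)

definition vert_elt :: "'v \<Rightarrow> 'g \<Rightarrow> ('v, 'g, 'e) gog_gen gword set" where
  "vert_elt v a = cls [(Vertex_Elt v a, True)]"

lemma P_arcs: "e \<in> P \<Longrightarrow> e \<in> arcs \<Gamma>"
  using orientation by (auto simp: orientation_def)

lemma arc_cases:
  assumes "e \<in> arcs \<Gamma>" obtains "e \<in> P" | "arev e \<in> P"
  using assms orientation unfolding orientation_def by (metis Un_iff arev_arev imageE)

lemma Vertex_Elt_gens [simp]: "Vertex_Elt v a \<in> gens \<longleftrightarrow> v \<in> verts \<Gamma> \<and> a \<in> carrier (vgrp v)"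
  by (auto simp: fg_gens_def)

lemma Stable_gens [simp]: "Stable e \<in> gens \<longleftrightarrow> e \<in> P"
  by (auto simp: fg_gens_def)

section \<open>Calculating in the fundamental group of a tree of groups\<close>

lemma PI_carrier: "carrier PI = cls ` gwords gens"
  by (auto simp: fundamental_group_def presented_group_def quotient_def)

lemma cls_carrier: "w \<in> gwords gens \<Longrightarrow> cls w \<in> carrier PI"
  by (auto simp: PI_carrier)

lemma cls_mult: "u \<in> gwords gens \<Longrightarrow> w \<in> gwords gens \<Longrightarrow> cls u \<otimes>\<^bsub>PI\<^esub> cls w = cls (u @ w)"
  unfolding fundamental_group_def by (rule presented_group_mult)

lemma cls_Nil: "cls [] = \<one>\<^bsub>PI\<^esub>"
  by (simp add: fundamental_group_def presented_group_def)

lemma cls_eqI: "(u, w) \<in> pres_rel gens rels \<Longrightarrow> cls u = cls w"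
  by (rule equiv_class_eq[OF equiv_pres_rel])

lemma cls_rel: "(u, w) \<in> rels \<Longrightarrow> u \<in> gwords gens \<Longrightarrow> w \<in> gwords gens \<Longrightarrow> cls u = cls w"
  by (intro cls_eqI pres_rel.relation)

lemma cls_False: "x \<in> gens \<Longrightarrow> cls [(x, False)] = inv\<^bsub>PI\<^esub> cls [(x, True)]"
proof -
  assume x: "x \<in> gens"
  have "cls [(x, False)] \<otimes>\<^bsub>PI\<^esub> cls [(x, True)] = \<one>\<^bsub>PI\<^esub>"
    using cls_eqI[OF pres_rel.cancel[OF x, of False rels]] x by (simp add: cls_mult cls_Nil)
  then show ?thesis using x by (intro PI.inv_equality[symmetric]) (auto intro: cls_carrier)
qed

text \<open>Every arc lies in the maximal tree, which is \<open>\<Gamma>\<close> here, so each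
  stable letter is killed by a relation.\<close>

lemma cls_Stable: "e \<in> P \<Longrightarrow> cls [(Stable e, b)] = \<one>\<^bsub>PI\<^esub>"
proof -
  assume e: "e \<in> P"
  then have "([(Stable e, True)], []) \<in> rels" using P_arcs by (auto simp: fg_rels_def)
  then have "cls [(Stable e, True)] = \<one>\<^bsub>PI\<^esub>" using cls_rel e cls_Nil by fastforce
  then show ?thesis using cls_False[of "Stable e"] e by (cases b) auto
qed

lemma vert_elt_hom: "v \<in> verts \<Gamma> \<Longrightarrow> vert_elt v \<in> hom (vgrp v) PI"
proof (rule homI)
  assume v: "v \<in> verts \<Gamma>"
  interpret V: group "vgrp v" using v group_vgrp by simp
  fix a b assume ab: "a \<in> carrier (vgrp v)" "b \<in> carrier (vgrp v)"
  have "cls [(Vertex_Elt v a, True), (Vertex_Elt v b, True)] = cls [(Vertex_Elt v (a \<otimes>\<^bsub>vgrp v\<^esub> b), True)]"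
    using ab v by (intro cls_rel) (auto simp: fg_rels_def)
  then show "vert_elt v (a \<otimes>\<^bsub>vgrp v\<^esub> b) = vert_elt v a \<otimes>\<^bsub>PI\<^esub> vert_elt v b"
    using ab v by (simp add: vert_elt_def cls_mult)
qed (auto simp: vert_elt_def intro: cls_carrier)

lemma vert_elt_group_hom: "v \<in> verts \<Gamma> \<Longrightarrow> group_hom (vgrp v) PI (vert_elt v)"
  by (intro group_hom.intro group_vgrp group_hom_axioms.intro vert_elt_hom PI.group_axioms)

lemma \<alpha>_hom: "e \<in> arcs \<Gamma> \<Longrightarrow> \<alpha> e \<in> hom (egrp e) (vgrp (tail \<Gamma> e))"
  using mon_\<alpha> by (simp add: mon_def)

lemma \<alpha>_closed: "e \<in> arcs \<Gamma> \<Longrightarrow> c \<in> carrier (egrp e) \<Longrightarrow> \<alpha> e c \<in> carrier (vgrp (tail \<Gamma> e))"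
  using \<alpha>_hom by (rule hom_in_carrier)

lemma \<alpha>_arev_closed: "e \<in> arcs \<Gamma> \<Longrightarrow> c \<in> carrier (egrp e) \<Longrightarrow> \<alpha> (arev e) c \<in> carrier (vgrp (head \<Gamma> e))"
  using \<alpha>_closed[of "arev e" c] egrp_arev by simp

text \<open>With trivial stable letters the edge relation becomes an equality of vertex elements.
  For an arc outside \<open>P\<close> it is the equality of the reverse arc read backwards.\<close>

lemma vert_elt_edge:
  assumes "e \<in> arcs \<Gamma>" "c \<in> carrier (egrp e)"
  shows "vert_elt (tail \<Gamma> e) (\<alpha> e c) = vert_elt (head \<Gamma> e) (\<alpha> (arev e) c)"
proof -
  have *: "vert_elt (tail \<Gamma> e) (\<alpha> e c) = vert_elt (head \<Gamma> e) (\<alpha> (arev e) c)"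
    if e: "e \<in> P" "c \<in> carrier (egrp e)" for e
  proof -
    let ?y = "[(Vertex_Elt (head \<Gamma> e) (\<alpha> (arev e) c), True)]"
    note arc = P_arcs[OF e(1)]
    have g: "?y \<in> gwords gens" using arc e \<alpha>_arev_closed by simp
    have "cls ([(Stable e, True)] @ ?y @ [(Stable e, False)]) = vert_elt (tail \<Gamma> e) (\<alpha> e c)"
      unfolding vert_elt_def using e arc g \<alpha>_closed by (intro cls_rel) (auto simp: fg_rels_def)
    moreover have "cls ([(Stable e, True)] @ ?y @ [(Stable e, False)]) =
        cls [(Stable e, True)] \<otimes>\<^bsub>PI\<^esub> (cls ?y \<otimes>\<^bsub>PI\<^esub> cls [(Stable e, False)])"
      using e g by (subst cls_mult, simp, simp)+ simp
    ultimately show ?thesis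
      using e cls_Stable[OF e(1)] cls_carrier[OF g] by (simp add: vert_elt_def)
  qed
  show ?thesis using assms(1)
  proof (cases rule: arc_cases)
    case 1 then show ?thesis using * assms by blast
  next
    case 2
    have "c \<in> carrier (egrp (arev e))" using assms egrp_arev by simp
    then show ?thesis using *[OF 2] assms by simp
  qed
qed

text \<open>Stable letters vanish, and the formal inverse of a vertex letter represents the vertex
  element of the inverse. So every word reduces to a product of vertex elements.\<close>

lemma PI_induct [consumes 1, case_names one mult]:
  assumes "x \<in> carrier PI" "Q \<one>\<^bsub>PI\<^esub>"
    and "\<And>v a x. v \<in> verts \<Gamma> \<Longrightarrow> a \<in> carrier (vgrp v) \<Longrightarrow> x \<in> carrier PI \<Longrightarrow> Q x \<Longrightarrow> Q (vert_elt v a \<otimes>\<^bsub>PI\<^esub> x)"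
  shows "Q x"
proof -
  obtain w where w: "w \<in> gwords gens" "x = cls w" using assms(1) by (auto simp: PI_carrier)
  have "Q (cls w)" using w(1)
  proof (induction w)
    case Nil then show ?case using assms(2) by (simp add: cls_Nil)
  next
    case (Cons l w)
    obtain g b where l: "l = (g, b)" by fastforce
    have g: "g \<in> gens" and w: "w \<in> gwords gens" "Q (cls w)" using Cons l by auto
    have eq: "cls (l # w) = cls [(g, b)] \<otimes>\<^bsub>PI\<^esub> cls w" using g w l by (simp add: cls_mult)
    show ?case
    proof (cases g)
      case (Stable e)
      then show ?thesis using eq w g cls_Stable cls_carrier by simp
    next
      case (Vertex_Elt v a)
      then have va: "v \<in> verts \<Gamma>" "a \<in> carrier (vgrp v)" using g by auto
      interpret h: group_hom "vgrp v" PI "vert_elt v" using vert_elt_group_hom va by simp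
      have "cls [(g, b)] = vert_elt v (if b then a else inv\<^bsub>vgrp v\<^esub> a)"
        using Vertex_Elt va g cls_False[of g] by (auto simp: vert_elt_def[symmetric])
      then show ?thesis using eq assms(3)[OF va(1) _ _ w(2)] va w cls_carrier by simp
    qed
  qed
  then show ?thesis using w by simp
qed

text \<open>Universal property: over a tree the group is the colimit of the vertex groups along the
  edge groups. Stable letters are sent to the identity.\<close>

lemma PI_hom:
  assumes L: "group L" and \<phi>: "\<And>v. v \<in> verts \<Gamma> \<Longrightarrow> \<phi> v \<in> hom (vgrp v) L"
    and compat: "\<And>e c. e \<in> arcs \<Gamma> \<Longrightarrow> c \<in> carrier (egrp e) \<Longrightarrow>
      \<phi> (tail \<Gamma> e) (\<alpha> e c) = \<phi> (head \<Gamma> e) (\<alpha> (arev e) c)"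
  obtains \<Phi> where "\<Phi> \<in> hom PI L"
    "\<And>v a. v \<in> verts \<Gamma> \<Longrightarrow> a \<in> carrier (vgrp v) \<Longrightarrow> \<Phi> (vert_elt v a) = \<phi> v a"
proof -
  interpret L: group L by fact
  define \<psi> where "\<psi> g = (case g of Vertex_Elt v a \<Rightarrow> \<phi> v a | Stable e \<Rightarrow> \<one>\<^bsub>L\<^esub>)" for g :: "('v, 'g, 'e) gog_gen"
  have \<phi>c: "\<phi> v a \<in> carrier L" if "v \<in> verts \<Gamma>" "a \<in> carrier (vgrp v)" for v a
    using \<phi>[OF that(1)] that(2) by (rule hom_in_carrier)
  have \<psi>: "\<psi> \<in> gens \<rightarrow> carrier L" by (auto simp: \<psi>_def \<phi>c split: gog_gen.split)
  have "word_eval L \<psi> u = word_eval L \<psi> w" if "(u, w) \<in> rels" for u w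
    using that P_arcs compat \<phi>c \<alpha>_closed \<alpha>_arev_closed hom_mult[OF \<phi>]
    by (auto simp: fg_rels_def \<psi>_def group.is_monoid[OF group_vgrp] monoid.m_closed)
  then obtain \<Phi> where "\<Phi> \<in> hom PI L" "\<And>w. w \<in> gwords gens \<Longrightarrow> \<Phi> (cls w) = word_eval L \<psi> w"
    unfolding fundamental_group_def using presented_group_hom[OF L \<psi>] by metis
  then show ?thesis using that[of \<Phi>] by (simp add: vert_elt_def \<psi>_def \<phi>c)
qed

end

section \<open>Characters with values in root-closed groups of complex numbers\<close>

text \<open>These exponents form a subgroup of the integers, and \<open>n\<close> is its nonnegative
  generator. The value \<open>n = 0\<close> covers the case that \<open>k = 0\<close> is the only
  such exponent.\<close>

lemma (in group) subgroup_period: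
  assumes C: "subgroup C G" and s: "s \<in> carrier G"
  obtains n :: nat where "\<And>k::int. s [^] k \<in> C \<longleftrightarrow> int n dvd k"
proof -
  interpret C: subgroup C G by fact
  have neg: "s [^] (- k) \<in> C" if "s [^] k \<in> C" for k :: int
    using C.m_inv_closed[OF that] s by (simp add: int_pow_neg)
  show ?thesis
  proof (cases "\<exists>n::nat>0. s [^] int n \<in> C")
    case False
    have "k = 0" if "s [^] k \<in> C" for k :: int
    proof (rule ccontr)
      assume "k \<noteq> 0"
      moreover have "s [^] int (nat \<bar>k\<bar>) \<in> C" using that neg by (simp add: abs_if)
      moreover have "nat \<bar>k\<bar> > 0" using \<open>k \<noteq> 0\<close> by simp
      ultimately show False using False by blast
    qed
    then show ?thesis using that[of 0] by force
  next
    case True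
    define n where "n = (LEAST n::nat. n > 0 \<and> s [^] int n \<in> C)"
    have n: "n > 0" "s [^] int n \<in> C" using LeastI_ex[OF True] by (simp_all add: n_def)
    have least: "n \<le> m" if "m > 0" "s [^] int m \<in> C" for m
      unfolding n_def by (rule Least_le) (use that in simp)
    have mult: "s [^] (int n * q) \<in> C" for q
      using subgroup_int_pow_closed[OF C n(2), of q] s by (simp add: int_pow_pow)
    have "int n dvd k" if k: "s [^] k \<in> C" for k :: int
    proof (rule ccontr)
      assume ndvd: "\<not> int n dvd k"
      have "s [^] (k mod int n) = s [^] (k - int n * (k div int n))"
        by (simp add: minus_mult_div_eq_mod)
      also have "\<dots> \<in> C" unfolding int_pow_diff[OF s] using k mult by simp
      finally have mem: "s [^] (k mod int n) \<in> C" .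
      have "0 \<le> k mod int n" "k mod int n < int n" "k mod int n \<noteq> 0"
        using n(1) ndvd by (simp_all add: mod_eq_0_iff_dvd)
      then obtain m where "k mod int n = int m" "m > 0" "m < n"
        by (metis nonneg_int_cases of_nat_less_iff of_nat_0 neq0_conv)
      then show False using least[of m] mem by simp
    qed
    moreover have "s [^] k \<in> C" if "int n dvd k" for k :: int
      using that mult by (auto simp: dvd_def)
    ultimately show ?thesis using that by blast
  qed
qed

text \<open>Divisible subgroups of the multiplicative group of the complex numbers. Divisibility is
  what lets characters with values in \<open>D\<close> extend from subgroups of abelian
  groups.\<close>

locale root_closed =
  fixes D :: "complex set"
  assumes one_D: "1 \<in> D" and zero_D: "0 \<notin> D"
    and mult_D: "z \<in> D \<Longrightarrow> w \<in> D \<Longrightarrow> z * w \<in> D"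
    and inverse_D: "z \<in> D \<Longrightarrow> inverse z \<in> D"
    and root_D: "z \<in> D \<Longrightarrow> n > 0 \<Longrightarrow> \<exists>w\<in>D. w ^ n = z"

definition cgrp :: "complex set \<Rightarrow> complex monoid" where
  "cgrp D = \<lparr>carrier = D, monoid.mult = (*), one = 1\<rparr>"

lemma cgrp_simps [simp]:
  "carrier (cgrp D) = D" "x \<otimes>\<^bsub>cgrp D\<^esub> y = x * y" "\<one>\<^bsub>cgrp D\<^esub> = 1"
  by (simp_all add: cgrp_def)

context root_closed
begin

lemma nonzero_D: "z \<in> D \<Longrightarrow> z \<noteq> 0"
  using zero_D by blast

sublocale cgrp: comm_group "cgrp D"
proof (rule comm_groupI)
  show "\<exists>y\<in>carrier (cgrp D). y \<otimes>\<^bsub>cgrp D\<^esub> x = \<one>\<^bsub>cgrp D\<^esub>" if "x \<in> carrier (cgrp D)" for x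
    using that inverse_D[of x] nonzero_D[of x] by (intro bexI[of _ "inverse x"]) auto
qed (auto simp: one_D mult_D)

lemma cgrp_inv: "z \<in> D \<Longrightarrow> inv\<^bsub>cgrp D\<^esub> z = inverse z"
  using nonzero_D inverse_D by (intro cgrp.inv_equality) auto

lemma cgrp_nat_pow: "z [^]\<^bsub>cgrp D\<^esub> (n::nat) = z ^ n"
  by (induction n) (simp_all add: mult.commute)

lemma cgrp_int_pow: "z \<in> D \<Longrightarrow> z [^]\<^bsub>cgrp D\<^esub> (k::int) = z powi k"
  using cgrp.nat_pow_closed[of z] 
  by (simp add: int_pow_def2 cgrp_nat_pow cgrp_inv power_int_def power_inverse)

lemma powi_D: "z \<in> D \<Longrightarrow> z powi k \<in> D"
  using cgrp.int_pow_closed[of z k] by (simp add: cgrp_int_pow)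

lemma hom_cgrp_int_pow:
  assumes "group B" "subgroup C B" "\<chi> \<in> hom (B\<lparr>carrier := C\<rparr>) (cgrp D)" "x \<in> C"
  shows "\<chi> (x [^]\<^bsub>B\<^esub> (k::int)) = \<chi> x powi k"
proof -
  interpret B: group B by fact
  have "\<chi> x \<in> D" using hom_in_carrier[OF assms(3)] assms(4) by simp
  then show ?thesis
    using hom_int_pow[OF assms(3) _ B.subgroup_imp_group[OF assms(2)] cgrp.is_group, of x k]
      B.int_pow_consistent[OF assms(2,4)] assms(4) by (simp add: cgrp_int_pow)
qed

text \<open>On the subgroup generated by \<open>C\<close> and \<open>s\<close> the extension sends
  \<open>c s^k\<close> to \<open>\<chi> c * z^k\<close>. The assumption \<open>compat\<close> is
  what makes this independent of the way an element is written.\<close>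

lemma extend_character_by_element:
  assumes "comm_group B" and C: "subgroup C B" and \<chi>: "\<chi> \<in> hom (B\<lparr>carrier := C\<rparr>) (cgrp D)"
    and s: "s \<in> carrier B" and z: "z \<in> D"
    and compat: "\<And>k::int. s [^]\<^bsub>B\<^esub> k \<in> C \<Longrightarrow> \<chi> (s [^]\<^bsub>B\<^esub> k) = z powi k"
  obtains C' \<chi>' where "subgroup C' B" "C \<subseteq> C'" "s \<in> C'" "\<chi>' \<in> hom (B\<lparr>carrier := C'\<rparr>) (cgrp D)"
    "\<And>c. c \<in> C \<Longrightarrow> \<chi>' c = \<chi> c" "\<chi>' s = z"
proof -
  interpret B: comm_group B by fact
  interpret C: subgroup C B by fact
  let ?m = "\<lambda>c (k::int). c \<otimes>\<^bsub>B\<^esub> s [^]\<^bsub>B\<^esub> k"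
  define C' where "C' = {?m c k | c k. c \<in> C}"
  define \<chi>' where "\<chi>' x = (let (c, k) = (SOME (c, k). c \<in> C \<and> x = ?m c k) in \<chi> c * z powi k)" for x
  have Cc: "c \<in> carrier B" if "c \<in> C" for c using that C.subset by blast
  have \<chi>D: "\<chi> c \<in> D" if "c \<in> C" for c using hom_in_carrier[OF \<chi>] that by simp
  have \<chi>m: "\<chi> (c \<otimes>\<^bsub>B\<^esub> d) = \<chi> c * \<chi> d" if "c \<in> C" "d \<in> C" for c d using hom_mult[OF \<chi>] that by simp
  have z0: "z \<noteq> 0" using z nonzero_D by blast
  have wd: "\<chi> c * z powi k = \<chi> d * z powi l" if "c \<in> C" "d \<in> C" "?m c k = ?m d l" for c d k l
  proof -
    have "c \<otimes>\<^bsub>B\<^esub> (s [^]\<^bsub>B\<^esub> (k - l)) = ?m c k \<otimes>\<^bsub>B\<^esub> inv\<^bsub>B\<^esub> (s [^]\<^bsub>B\<^esub> l)"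
      using that(1,2) s Cc by (simp add: B.int_pow_diff B.m_assoc)
    also have "\<dots> = d" unfolding that(3) using that(1,2) s Cc by (simp add: B.m_assoc)
    finally have eq: "c \<otimes>\<^bsub>B\<^esub> (s [^]\<^bsub>B\<^esub> (k - l)) = d" .
    then have "s [^]\<^bsub>B\<^esub> (k - l) = inv\<^bsub>B\<^esub> c \<otimes>\<^bsub>B\<^esub> d"
      using that s Cc by (metis B.int_pow_closed B.inv_solve_left')
    then have "s [^]\<^bsub>B\<^esub> (k - l) \<in> C" using that by simp
    then have "\<chi> d = \<chi> c * z powi (k - l)" using \<chi>m[OF that(1)] compat eq by metis
    then show ?thesis using z0 by (simp add: power_int_diff)
  qed
  have \<chi>': "\<chi>' (?m c k) = \<chi> c * z powi k" if "c \<in> C" for c k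
  proof -
    have "case (SOME (d, l). d \<in> C \<and> ?m c k = ?m d l) of (d, l) \<Rightarrow> d \<in> C \<and> ?m c k = ?m d l"
      by (rule someI[of _ "(c, k)"]) (use that in auto)
    then show ?thesis unfolding \<chi>'_def Let_def using wd[OF that] by (auto split: prod.splits)
  qed
  have mm: "?m c k \<otimes>\<^bsub>B\<^esub> ?m d l = ?m (c \<otimes>\<^bsub>B\<^esub> d) (k + l)" if "c \<in> C" "d \<in> C" for c d k l
    using that s Cc by (simp add: B.int_pow_mult B.m_ac)
  have one: "?m \<one>\<^bsub>B\<^esub> 0 = \<one>\<^bsub>B\<^esub>" by simp
  have C'c: "C' \<subseteq> carrier B" using Cc s by (auto simp: C'_def)
  have "subgroup C' B"
  proof (rule B.subgroupI)
    have "?m \<one>\<^bsub>B\<^esub> 0 \<in> C'" unfolding C'_def using C.one_closed by blast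
    then show "C' \<noteq> {}" by blast
    show "inv\<^bsub>B\<^esub> a \<in> C'" if "a \<in> C'" for a
    proof -
      obtain c k where ck: "c \<in> C" "a = ?m c k" using \<open>a \<in> C'\<close> by (auto simp: C'_def)
      then have "inv\<^bsub>B\<^esub> a = ?m (inv\<^bsub>B\<^esub> c) (- k)" using Cc s by (simp add: B.inv_mult B.int_pow_neg)
      then show ?thesis using ck by (auto simp: C'_def)
    qed
    show "a \<otimes>\<^bsub>B\<^esub> b \<in> C'" if "a \<in> C'" "b \<in> C'" for a b
      using that unfolding C'_def by (auto simp: mm) (metis C.m_closed)
  qed (use C'c in auto)
  moreover have CC': "C \<subseteq> C'"
  proof
    fix c assume "c \<in> C"
    moreover have "c = ?m c 0" using \<open>c \<in> C\<close> Cc by simp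
    ultimately show "c \<in> C'" unfolding C'_def by blast
  qed
  moreover have s1: "s = ?m \<one>\<^bsub>B\<^esub> 1" using s by (simp add: B.int_pow_1)
  then have "s \<in> C'" unfolding C'_def using C.one_closed by blast
  moreover have "\<chi>' \<in> hom (B\<lparr>carrier := C'\<rparr>) (cgrp D)"
  proof (rule homI)
    fix x assume "x \<in> carrier (B\<lparr>carrier := C'\<rparr>)"
    then show "\<chi>' x \<in> carrier (cgrp D)"
      using \<chi>' \<chi>D z powi_D mult_D by (auto simp: C'_def)
  next
    fix x y assume "x \<in> carrier (B\<lparr>carrier := C'\<rparr>)" "y \<in> carrier (B\<lparr>carrier := C'\<rparr>)"
    then obtain c k d l where "c \<in> C" "d \<in> C" "x = ?m c k" "y = ?m d l" by (auto simp: C'_def)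
    then show "\<chi>' (x \<otimes>\<^bsub>B\<lparr>carrier := C'\<rparr>\<^esub> y) = \<chi>' x \<otimes>\<^bsub>cgrp D\<^esub> \<chi>' y"
      using z0 by (simp add: mm \<chi>' \<chi>m power_int_add)
  qed
  moreover have \<chi>1: "\<chi> \<one>\<^bsub>B\<^esub> = 1"
    using \<chi>m[of "\<one>\<^bsub>B\<^esub>" "\<one>\<^bsub>B\<^esub>"] nonzero_D[OF \<chi>D[of "\<one>\<^bsub>B\<^esub>"]] by simp
  moreover have "\<chi>' c = \<chi> c" if "c \<in> C" for c using \<chi>'[OF that, of 0] Cc[OF that] by simp
  moreover have "\<chi>' s = z" using \<chi>'[of "\<one>\<^bsub>B\<^esub>" 1] s1 \<chi>1 by simp
  ultimately show ?thesis using that by blast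
qed

text \<open>If the powers of \<open>s\<close> in \<open>C\<close> are those with exponent divisible
  by \<open>n\<close>, any \<open>n\<close>-th root of the value at \<open>s^n\<close> will do, and
  \<open>D\<close> contains one. For \<open>n = 0\<close> there is no constraint and 1
  serves.\<close>

lemma ex_compatible_value:
  assumes "group B" and C: "subgroup C B" and \<chi>: "\<chi> \<in> hom (B\<lparr>carrier := C\<rparr>) (cgrp D)"
    and s: "s \<in> carrier B"
  obtains z where "z \<in> D" "\<And>k::int. s [^]\<^bsub>B\<^esub> k \<in> C \<Longrightarrow> \<chi> (s [^]\<^bsub>B\<^esub> k) = z powi k"
proof -
  interpret B: group B by fact
  interpret C: subgroup C B by fact
  have \<chi>D: "\<chi> c \<in> D" if "c \<in> C" for c using hom_in_carrier[OF \<chi>] that by simp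
  obtain n where n: "\<And>k::int. s [^]\<^bsub>B\<^esub> k \<in> C \<longleftrightarrow> int n dvd k"
    using B.subgroup_period[OF C s] by blast
  have sn: "s [^]\<^bsub>B\<^esub> int n \<in> C" using n by simp
  obtain z where z: "z \<in> D" "z ^ n = \<chi> (s [^]\<^bsub>B\<^esub> int n)"
  proof (cases "n = 0")
    case True
    have "\<chi> \<one>\<^bsub>B\<^esub> = 1"
      using hom_mult[OF \<chi>, of "\<one>\<^bsub>B\<^esub>" "\<one>\<^bsub>B\<^esub>"] nonzero_D[OF \<chi>D[of "\<one>\<^bsub>B\<^esub>"]] by simp
    then show ?thesis using that[of 1] one_D True by simp
  next
    case False
    then show ?thesis using root_D[OF \<chi>D[OF sn], of n] that by blast
  qed
  have "\<chi> (s [^]\<^bsub>B\<^esub> k) = z powi k" if k: "s [^]\<^bsub>B\<^esub> k \<in> C" for k :: int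
  proof -
    obtain q where q: "k = int n * q" using k n by (auto simp: dvd_def)
    have "\<chi> (s [^]\<^bsub>B\<^esub> k) = \<chi> (s [^]\<^bsub>B\<^esub> int n) powi q"
      using hom_cgrp_int_pow[OF \<open>group B\<close> C \<chi> sn] s by (simp add: q B.int_pow_pow)
    also have "\<dots> = z powi k" by (simp add: q power_int_power flip: z(2))
    finally show ?thesis .
  qed
  then show ?thesis using that z(1) by blast
qed

text \<open>Injectivity of divisible groups. Finite generation of \<open>B\<close> reduces it to an
  induction that adjoins one generator at a time.\<close>

lemma extend_character:
  assumes B: "comm_group B" "finitely_generated_group B" and C: "subgroup C B"
    and \<chi>: "\<chi> \<in> hom (B\<lparr>carrier := C\<rparr>) (cgrp D)"
  obtains \<chi>' where "\<chi>' \<in> hom B (cgrp D)" "\<And>c. c \<in> C \<Longrightarrow> \<chi>' c = \<chi> c"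
proof -
  interpret B: comm_group B by fact
  obtain S where S: "finite S" "S \<subseteq> carrier B" "generate B S = carrier B"
    using B(2) by (auto simp: finitely_generated_group_def)
  have "\<exists>C' \<chi>'. subgroup C' B \<and> C \<subseteq> C' \<and> S \<subseteq> C' \<and> \<chi>' \<in> hom (B\<lparr>carrier := C'\<rparr>) (cgrp D) \<and>
    (\<forall>c\<in>C. \<chi>' c = \<chi> c)"
    using S(1,2)
  proof (induction S)
    case empty
    then show ?case using C \<chi> by blast
  next
    case (insert s S)
    then obtain C' \<chi>' where C': "subgroup C' B" "C \<subseteq> C'" "S \<subseteq> C'"
      "\<chi>' \<in> hom (B\<lparr>carrier := C'\<rparr>) (cgrp D)" "\<forall>c\<in>C. \<chi>' c = \<chi> c" by auto
    have s: "s \<in> carrier B" using insert by simp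
    obtain z where "z \<in> D" "\<And>k::int. s [^]\<^bsub>B\<^esub> k \<in> C' \<Longrightarrow> \<chi>' (s [^]\<^bsub>B\<^esub> k) = z powi k"
      using ex_compatible_value[OF B.is_group C'(1,4) s] by blast
    from extend_character_by_element[OF B(1) C'(1,4) s this] obtain C'' \<chi>'' where
      "subgroup C'' B" "C' \<subseteq> C''" "s \<in> C''" "\<chi>'' \<in> hom (B\<lparr>carrier := C''\<rparr>) (cgrp D)"
      "\<And>c. c \<in> C' \<Longrightarrow> \<chi>'' c = \<chi>' c" by metis
    then show ?case using C' by (intro exI[of _ C''] exI[of _ \<chi>'']) auto
  qed
  then obtain C' \<chi>' where C': "subgroup C' B" "S \<subseteq> C'" "\<chi>' \<in> hom (B\<lparr>carrier := C'\<rparr>) (cgrp D)"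
    "\<forall>c\<in>C. \<chi>' c = \<chi> c" by blast
  have "C' = carrier B" using B.generate_subgroup_incl[OF C'(2,1)] S(3) subgroup.subset[OF C'(1)] by auto
  then show ?thesis using that[of \<chi>'] C' by simp
qed

end

text \<open>Large enough to be closed under all roots, yet each element has a power among the powers
  of \<open>h\<close>; for finitely generated groups this gives the preimage of the cyclic group of
  \<open>h\<close> finite index. For \<open>h = 1\<close> it consists of all roots of unity.\<close>

definition radical_hull :: "complex \<Rightarrow> complex set" where
  "radical_hull h = {z. z \<noteq> 0 \<and> (\<exists>m>0. \<exists>k::int. z ^ m = h powi k)}"

lemma complex_root:
  fixes z :: complex assumes "n > 0" obtains w where "w ^ n = z"
proof
  show "rcis (root n (cmod z)) (Arg z / real n) ^ n = z"
    using assms by (simp add: DeMoivre2 rcis_cmod_Arg)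
qed

lemma root_closed_radical_hull:
  assumes "h \<noteq> 0" shows "root_closed (radical_hull h)"
proof
  have "(1::complex) \<noteq> 0" "(1::complex) ^ 1 = h powi 0" by simp_all
  then show "1 \<in> radical_hull h" unfolding radical_hull_def using zero_less_one by blast
  show "0 \<notin> radical_hull h" by (simp add: radical_hull_def)
next
  fix z w assume "z \<in> radical_hull h" "w \<in> radical_hull h"
  then obtain m k n l where zw: "z \<noteq> 0" "w \<noteq> 0" "m > 0" "n > 0" "z ^ m = h powi k" "w ^ n = h powi l"
    by (auto simp: radical_hull_def)
  have "(z * w) ^ (m * n) = (z ^ m) ^ n * (w ^ n) ^ m"
    by (simp add: power_mult_distrib mult.commute flip: power_mult)
  also have "\<dots> = h powi (k * int n + l * int m)"
    using assms zw by (simp add: power_int_add power_int_power')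
  finally show "z * w \<in> radical_hull h" using zw unfolding radical_hull_def
    by (auto intro!: exI[of _ "m * n"])
next
  fix z assume "z \<in> radical_hull h"
  then obtain m k where zw: "z \<noteq> 0" "m > 0" "z ^ m = h powi k" by (auto simp: radical_hull_def)
  then have "inverse z ^ m = h powi (- k)" by (simp add: power_inverse power_int_minus)
  then show "inverse z \<in> radical_hull h" using zw unfolding radical_hull_def by auto
next
  fix z and n :: nat assume "z \<in> radical_hull h" "n > 0"
  then obtain m k where zw: "z \<noteq> 0" "m > 0" "z ^ m = h powi k" by (auto simp: radical_hull_def)
  obtain w where w: "w ^ n = z" using complex_root[OF \<open>n > 0\<close>] by blast
  then have "w ^ (n * m) = h powi k" using zw by (simp add: power_mult)
  moreover have "w \<noteq> 0" using w zw \<open>n > 0\<close> by auto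
  moreover have "n * m > 0" using zw \<open>n > 0\<close> by simp
  ultimately have "w \<in> radical_hull h" unfolding radical_hull_def by blast
  then show "\<exists>w\<in>radical_hull h. w ^ n = z" using w by blast
qed

lemma powi_in_radical_hull:
  assumes "h \<noteq> 0" shows "h powi k \<in> radical_hull h"
proof -
  have "h powi k \<noteq> 0" "(h powi k) ^ 1 = h powi k" using assms by simp_all
  then show ?thesis unfolding radical_hull_def using zero_less_one by blast
qed

section \<open>Complex numbers of prescribed order and separating characters\<close>

lemma cis_eq_1_iff: "cis (2 * pi * of_int k / of_nat n) = 1 \<longleftrightarrow> int n dvd k" if "n > 0"
proof -
  have "int n dvd k" if "cis (2 * pi * of_int k / of_nat n) = 1"
  proof -
    have "cos (2 * pi * of_int k / of_nat n) = 1" using that by (auto simp: complex_eq_iff)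
    then obtain j :: int where "2 * pi * of_int k / of_nat n = of_int j * 2 * pi"
      unfolding cos_one_2pi_int by blast
    then have "real_of_int k = real_of_int (int n * j)" using \<open>n > 0\<close> by (simp add: field_simps)
    then show ?thesis by (metis dvd_triv_left of_int_eq_iff)
  qed
  moreover have "cis (2 * pi * of_int k / of_nat n) = 1" if "int n dvd k"
    using that \<open>n > 0\<close> cis_multiple_2pi by (auto simp: dvd_def mult.assoc)
  ultimately show ?thesis by blast
qed

text \<open>Infinite order is realised by 2, whose powers have distinct moduli, and finite order by
  a primitive root of unity.\<close>

lemma (in group) ex_complex_same_order:
  assumes "a \<in> carrier G"
  obtains h :: complex where "h \<noteq> 0" "\<And>k::int. h powi k = 1 \<longleftrightarrow> a [^] k = \<one>"
proof (cases "ord a = 0")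
  case True
  have "(2::complex) powi k = 1 \<longleftrightarrow> k = 0" for k :: int
  proof
    assume "(2::complex) powi k = 1"
    then have "norm ((2::complex) powi k) = 1" by simp
    then have "(2::real) powi k = 1" by (simp add: norm_power_int)
    then show "k = 0" 
      using power_int_strict_increasing[of 0 k "2::real"] power_int_strict_increasing[of k 0 "2::real"]
      by (cases k "0::int" rule: linorder_cases) auto
  qed simp
  then show ?thesis using that[of 2] int_pow_eq_id[OF assms] True by simp
next
  case False
  have "cis (2 * pi / ord a) powi k = 1 \<longleftrightarrow> a [^] k = \<one>" for k :: int
    using cis_eq_1_iff[of "ord a" k] False int_pow_eq_id[OF assms] by (simp add: cis_power_int mult_ac)
  then show ?thesis using that cis_neq_zero by blast
qed

text \<open>Let \<open>n\<close> be the period of \<open>a\<close> modulo \<open>C\<close>; it is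
  not 1 as \<open>a\<close> lies outside \<open>C\<close>. The trivial character of \<open>C\<close>
  extends with a primitive \<open>n\<close>-th root of unity as value at \<open>a\<close>, or with
  -1 if \<open>n = 0\<close>. Values among the roots of unity will give the character a finite
  range.\<close>

lemma separating_character:
  assumes "comm_group B" "finitely_generated_group B" and C: "subgroup C B"
    and a: "a \<in> carrier B" "a \<notin> C"
  obtains \<chi> where "\<chi> \<in> hom B (cgrp (radical_hull 1))" "\<And>c. c \<in> C \<Longrightarrow> \<chi> c = 1" "\<chi> a \<noteq> 1"
proof -
  interpret B: comm_group B by fact
  interpret D: root_closed "radical_hull 1" by (rule root_closed_radical_hull) simp
  obtain n where n: "\<And>k::int. a [^]\<^bsub>B\<^esub> k \<in> C \<longleftrightarrow> int n dvd k"
    using B.subgroup_period[OF C a(1)] by blast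
  have n1: "n \<noteq> 1" using n[of 1] a by (auto simp: B.int_pow_1)
  obtain z :: complex where z: "z \<in> radical_hull 1" "z \<noteq> 1" "\<And>k::int. int n dvd k \<Longrightarrow> z powi k = 1"
  proof (cases "n = 0")
    case True
    have "(-1 :: complex) ^ 2 = 1 powi 0" "(-1 :: complex) \<noteq> 0" by simp_all
    then have "(-1 :: complex) \<in> radical_hull 1" unfolding radical_hull_def using zero_less_numeral by blast
    then show ?thesis using that[of "-1"] True by simp
  next
    case False
    let ?z = "cis (2 * pi / n)"
    have pw: "?z powi k = 1 \<longleftrightarrow> int n dvd k" for k
      using cis_eq_1_iff[of n k] False by (simp add: cis_power_int mult_ac)
    have "?z ^ n = 1 powi 0" using pw[of "int n"] by simp
    then have "?z \<in> radical_hull 1" unfolding radical_hull_def using False cis_neq_zero neq0_conv by blast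
    moreover have "?z \<noteq> 1" using pw[of 1] n1 by auto
    ultimately show ?thesis using that pw by blast
  qed
  have triv: "(\<lambda>_. 1) \<in> hom (B\<lparr>carrier := C\<rparr>) (cgrp (radical_hull 1))"
    by (rule homI) (auto simp: D.one_D)
  have "1 = z powi k" if "a [^]\<^bsub>B\<^esub> k \<in> C" for k :: int using z(3) that n by simp
  from D.extend_character_by_element[OF \<open>comm_group B\<close> C triv a(1) z(1) this]
  obtain C' \<chi> where C': "subgroup C' B" "C \<subseteq> C'" "a \<in> C'"
    "\<chi> \<in> hom (B\<lparr>carrier := C'\<rparr>) (cgrp (radical_hull 1))" "\<And>c. c \<in> C \<Longrightarrow> \<chi> c = 1" "\<chi> a = z" by metis
  obtain \<chi>' where "\<chi>' \<in> hom B (cgrp (radical_hull 1))" "\<And>c. c \<in> C' \<Longrightarrow> \<chi>' c = \<chi> c"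
    using D.extend_character[OF assms(1,2) C'(1,4)] by blast
  then show ?thesis using that[of \<chi>'] C' z(2) by (metis subsetD)
qed

section \<open>Virtual retractions onto cyclic subgroups\<close>

text \<open>\<open>q\<close> is an invariant that determines the right coset of \<open>x\<close>, so
  its finitely many values bound the index.\<close>

lemma (in group) finite_rcosetsI:
  assumes K: "subgroup K G" and fin: "finite (q ` carrier G)"
    and q: "\<And>x y. x \<in> carrier G \<Longrightarrow> y \<in> carrier G \<Longrightarrow> q x = q y \<Longrightarrow> x \<otimes> inv y \<in> K"
  shows "finite (rcosets K)"
proof -
  have eq: "K #> x = K #> y" if "x \<in> carrier G" "y \<in> carrier G" "q x = q y" for x y
  proof -
    have "x = x \<otimes> inv y \<otimes> y" using that by (simp add: m_assoc)
    then have "x \<in> K #> y" using q[OF that] unfolding r_coset_def by blast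
    then show ?thesis using repr_independence[OF _ that(2) K] by simp
  qed
  have "rcosets K \<subseteq> (\<lambda>t. K #> (SOME x. x \<in> carrier G \<and> q x = t)) ` q ` carrier G"
  proof
    fix C assume "C \<in> rcosets K"
    then obtain x where x: "x \<in> carrier G" "C = K #> x" by (auto simp: RCOSETS_def)
    define y where "y = (SOME y. y \<in> carrier G \<and> q y = q x)"
    have "y \<in> carrier G \<and> q y = q x" unfolding y_def by (rule someI[of _ x]) (use x in simp)
    then have "C = K #> y" using eq[of x y] x by simp
    then show "C \<in> (\<lambda>t. K #> (SOME x. x \<in> carrier G \<and> q x = t)) ` q ` carrier G"
      using x by (auto simp: y_def)
  qed
  then show ?thesis using fin finite_subset by blast
qed

lemma (in group) conjugation_hom:
  assumes "x \<in> carrier G"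
  shows "(\<lambda>z. x \<otimes> z \<otimes> inv x) \<in> hom G G"
proof -
  have "inv x \<otimes> (x \<otimes> z) = z" if "z \<in> carrier G" for z
    using assms(1) that by (simp flip: m_assoc)
  then show ?thesis using assms(1) by (intro homI) (simp_all add: m_assoc)
qed

lemma (in group) int_pow_conjugate:
  assumes "x \<in> carrier G" "a \<in> carrier G"
  shows "(x \<otimes> a \<otimes> inv x) [^] (k::int) = x \<otimes> a [^] k \<otimes> inv x"
  using hom_int_pow[OF conjugation_hom[OF assms(1)] assms(2) is_group is_group] by simp

text \<open>The retraction sends \<open>x\<close> to \<open>g^(E x)\<close>. Asking for additivity
  of \<open>E\<close> only in the exponent of \<open>g\<close> treats finite and infinite order
  alike.\<close>

lemma (in group) virtual_retract_powersI:
  fixes E :: "'a \<Rightarrow> int"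
  assumes K: "subgroup K G" "finite (rcosets K)" and g: "g \<in> K"
    and E: "\<And>x y. x \<in> K \<Longrightarrow> y \<in> K \<Longrightarrow> g [^] E (x \<otimes> y) = g [^] (E x + E y)" "g [^] E g = g"
  shows "virtual_retract G (range (\<lambda>k::int. g [^] k))"
proof -
  let ?H = "range (\<lambda>k::int. g [^] k)" and ?\<rho> = "\<lambda>x. g [^] E x"
  have gc: "g \<in> carrier G" using g subgroup.subset[OF K(1)] by blast
  have H: "subgroup ?H G"
  proof (rule subgroupI)
    have "inv (g [^] k) = g [^] (- k)" "g [^] k \<otimes> g [^] l = g [^] (k + l)" for k l :: int
      using gc by (simp_all add: int_pow_neg int_pow_mult)
    then have *: "inv (g [^] k) \<in> ?H" "g [^] k \<otimes> g [^] l \<in> ?H" for k l :: int by simp_all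
    show "inv a \<in> ?H" if "a \<in> ?H" for a using *(1) that by blast
    show "a \<otimes> b \<in> ?H" if "a \<in> ?H" "b \<in> ?H" for a b using *(2) that by blast
  qed (use gc in auto)
  have HK: "?H \<subseteq> K" using subgroup_int_pow_closed[OF K(1) g] by auto
  have hom: "?\<rho> \<in> hom (G\<lparr>carrier := K\<rparr>) (G\<lparr>carrier := ?H\<rparr>)"
    using E(1) gc by (auto intro!: homI simp: int_pow_mult)
  have "?\<rho> (g [^] k) = g [^] k" for k :: int
  proof -
    have "?\<rho> (g [^]\<^bsub>G\<lparr>carrier := K\<rparr>\<^esub> k) = ?\<rho> g [^]\<^bsub>G\<lparr>carrier := ?H\<rparr>\<^esub> k"
      by (rule hom_int_pow[OF hom _ subgroup_imp_group[OF K(1)] subgroup_imp_group[OF H]]) (use g in simp)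
    moreover have "g \<in> ?H" using gc int_pow_1[of g] by (metis rangeI)
    ultimately show ?thesis
      using int_pow_consistent[OF K(1) g, of k] int_pow_consistent[OF H, of g k] E(2) by simp
  qed
  then show ?thesis
    unfolding virtual_retract_def using H K HK hom by (intro conjI exI[of _ K] bexI[of _ ?\<rho>]) auto
qed

text \<open>Each generator has an exponent of its own. The product of these finitely many exponents
  serves all generators, and then all elements because the target is commutative.\<close>

lemma (in group) radical_hull_exponent:
  assumes fg: "finitely_generated_group G" and h: "h \<noteq> 0" and f: "f \<in> hom G (cgrp (radical_hull h))"
  obtains M where "M > 0" "\<And>x. x \<in> carrier G \<Longrightarrow> \<exists>k::int. f x ^ M = h powi k"
proof -
  interpret D: root_closed "radical_hull h" by (rule root_closed_radical_hull) fact
  obtain S where S: "finite S" "S \<subseteq> carrier G" "generate G S = carrier G"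
    using fg by (auto simp: finitely_generated_group_def)
  have fD: "f x \<in> radical_hull h" if "x \<in> carrier G" for x using hom_in_carrier[OF f that] by simp
  have "\<exists>m>0. \<exists>k::int. f s ^ m = h powi k" if "s \<in> S" for s
    using fD[of s] S(2) that by (auto simp: radical_hull_def)
  then obtain m where m: "\<And>s. s \<in> S \<Longrightarrow> m s > 0" "\<And>s. s \<in> S \<Longrightarrow> \<exists>k::int. f s ^ m s = h powi k" by metis
  define M where "M = prod m S"
  have gen: "\<exists>k::int. f s ^ M = h powi k" if "s \<in> S" for s
  proof -
    obtain d where "M = m s * d" using \<open>s \<in> S\<close> S(1) by (auto simp: M_def dest: dvd_prodI[of _ _ m])
    moreover obtain k :: int where "f s ^ m s = h powi k" using m(2) \<open>s \<in> S\<close> by blast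
    ultimately have "f s ^ M = h powi (k * int d)" by (simp add: power_mult power_int_power')
    then show ?thesis by blast
  qed
  have f1: "f \<one> = 1" using hom_one[OF f is_group D.cgrp.is_group] by simp
  have "\<exists>k::int. f x ^ M = h powi k" if "x \<in> generate G S" for x
    using that
  proof (induction rule: generate.induct)
    case one then show ?case using f1 by (intro exI[of _ 0]) simp
  next
    case (incl s) then show ?case using gen by blast
  next
    case (inv s)
    have s: "s \<in> carrier G" using inv S by blast
    then have "f s * f (inv s) = 1" using hom_mult[OF f, of s "inv s"] f1 by simp
    then have "f (inv s) = inverse (f s)" by (intro inverse_unique[symmetric])
    moreover obtain k :: int where "f s ^ M = h powi k" using gen inv by blast
    ultimately have "f (inv s) ^ M = h powi (- k)" by (simp add: power_inverse power_int_minus)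
    then show ?case by blast
  next
    case (eng x y)
    then obtain k l :: int where "f x ^ M = h powi k" "f y ^ M = h powi l" by blast
    moreover have "x \<in> carrier G" "y \<in> carrier G" using eng S(3) by auto
    ultimately have "f (x \<otimes> y) ^ M = h powi (k + l)"
      using hom_mult[OF f, of x y] h by (simp add: power_mult_distrib power_int_add)
    then show ?case by blast
  qed
  moreover have "M > 0" using m(1) S(1) by (simp add: M_def prod_pos)
  ultimately show ?thesis using that S(3) by blast
qed

text \<open>By \<open>faithful\<close>, \<open>f\<close> maps the powers of \<open>g\<close>
  isomorphically onto the powers of \<open>h\<close>. On the preimage \<open>K\<close> of the
  latter, \<open>f\<close> followed by the inverse isomorphism is a retraction.\<close>

lemma (in group) virtual_retract_of_character:
  assumes fg: "finitely_generated_group G" and h: "h \<noteq> 0" and f: "f \<in> hom G (cgrp (radical_hull h))"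
    and g: "g \<in> carrier G" "f g = h" and faithful: "\<And>k::int. h powi k = 1 \<Longrightarrow> g [^] k = \<one>"
  shows "virtual_retract G (range (\<lambda>k::int. g [^] k))"
proof -
  interpret D: root_closed "radical_hull h" by (rule root_closed_radical_hull) fact
  obtain M where M: "M > 0" "\<And>x. x \<in> carrier G \<Longrightarrow> \<exists>k::int. f x ^ M = h powi k"
    using radical_hull_exponent[OF fg h f] by blast
  have fm: "f (x \<otimes> y) = f x * f y" if "x \<in> carrier G" "y \<in> carrier G" for x y
    using hom_mult[OF f that] by simp
  have f0: "f x \<noteq> 0" if "x \<in> carrier G" for x
    using hom_in_carrier[OF f that] D.nonzero_D by simp
  have f1: "f \<one> = 1" using hom_one[OF f is_group D.cgrp.is_group] by simp
  have finv: "f (inv x) = inverse (f x)" if "x \<in> carrier G" for x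
    using fm[of x "inv x"] f1 that by (intro inverse_unique[symmetric]) simp
  have eqg: "g [^] k = g [^] l" if "h powi k = h powi l" for k l :: int
  proof -
    have "h powi (k - l) = 1" using that h by (simp add: power_int_diff)
    then have "g [^] k \<otimes> inv (g [^] l) = \<one>" using faithful g by (simp flip: int_pow_diff)
    then show ?thesis using g by (metis int_pow_closed inv_closed inv_inv inv_equality)
  qed
  define K where "K = {x \<in> carrier G. \<exists>k::int. f x = h powi k}"
  define E where "E x = (SOME k::int. f x = h powi k)" for x
  have E: "f x = h powi E x" if "x \<in> K" for x
    using that someI_ex[of "\<lambda>k::int. f x = h powi k"] by (auto simp: K_def E_def)
  have K: "subgroup K G"
  proof (rule subgroupI)
    have "f \<one> = h powi 0" using f1 by simp
    then show "K \<noteq> {}" unfolding K_def by blast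
    show "inv a \<in> K" if a: "a \<in> K" for a
    proof -
      obtain k where "a \<in> carrier G" "f a = h powi k" using a by (auto simp: K_def)
      then have "f (inv a) = h powi (- k)" "inv a \<in> carrier G"
        using finv by (simp_all add: power_int_minus)
      then show ?thesis unfolding K_def by blast
    qed
    show "a \<otimes> b \<in> K" if ab: "a \<in> K" "b \<in> K" for a b
    proof -
      obtain k l where "a \<in> carrier G" "f a = h powi k" "b \<in> carrier G" "f b = h powi l"
        using ab by (auto simp: K_def)
      then have "f (a \<otimes> b) = h powi (k + l)" "a \<otimes> b \<in> carrier G"
        using fm h by (simp_all add: power_int_add)
      then show ?thesis unfolding K_def by blast
    qed
  qed (auto simp: K_def)
  define p where "p x = (SOME k::int. f x ^ M = h powi k)" for x
  \<comment> \<open>The value \<open>f x\<close> is divided by a power of \<open>h\<close> so that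
    its \<open>M\<close>-th power becomes one of \<open>h^0, ..., h^(M-1)\<close>. Each of these has
    finitely many \<open>M\<close>-th roots, and elements with equal \<open>q\<close> have values
    that differ by a power of \<open>h\<close>.\<close>
  define q where "q x = f x / h powi (p x div int M)" for x
  have q: "q x ^ M = h powi (p x mod int M)" if "x \<in> carrier G" for x
  proof -
    have "f x ^ M = h powi p x" unfolding p_def using someI_ex[OF M(2)[OF that]] .
    then have "q x ^ M = h powi (p x - (p x div int M) * int M)"
      using h by (simp add: q_def power_divide power_int_diff power_int_power')
    then show ?thesis by (simp add: minus_div_mult_eq_mod)
  qed
  have "finite (rcosets K)"
  proof (rule finite_rcosetsI[OF K, of q])
    have "q ` carrier G \<subseteq> (\<Union>j\<in>{0..<int M}. {z. z ^ M = h powi j})"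
      using q M(1) by (auto intro!: bexI[of _ "p _ mod int M"])
    then show "finite (q ` carrier G)" by (rule finite_subset) (use M(1) in auto)
  next
    fix x y assume xy: "x \<in> carrier G" "y \<in> carrier G" "q x = q y"
    then have "f x / f y = h powi (p x div int M - p y div int M)"
      using h f0 by (simp add: q_def power_int_diff field_simps)
    then have "f (x \<otimes> inv y) = h powi (p x div int M - p y div int M)"
      using xy fm finv by (simp add: divide_inverse)
    then show "x \<otimes> inv y \<in> K" using xy by (auto simp: K_def)
  qed
  moreover have "f g = h powi 1" using g by simp
  then have gK: "g \<in> K" using g unfolding K_def by blast
  moreover have "g [^] E (x \<otimes> y) = g [^] (E x + E y)" if "x \<in> K" "y \<in> K" for x y
  proof (rule eqg)
    have "x \<in> carrier G" "y \<in> carrier G" using that by (auto simp: K_def)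
    then show "h powi E (x \<otimes> y) = h powi (E x + E y)"
      using that E fm E[OF subgroup.m_closed[OF K that]] h by (simp add: power_int_add)
  qed
  moreover have "g [^] E g = g"
    using eqg[of "E g" 1] E[OF gK] g by (simp add: int_pow_1)
  ultimately show ?thesis using virtual_retract_powersI[OF K] by blast
qed

section \<open>Characters of the fundamental group and elliptic elements\<close>

context abelian_tree
begin

lemma finitely_generated_PI: "finitely_generated_group PI"
proof -
  have "\<forall>v\<in>verts \<Gamma>. \<exists>S. finite S \<and> S \<subseteq> carrier (vgrp v) \<and> generate (vgrp v) S = carrier (vgrp v)"
    using fin_gen_vgrp unfolding finitely_generated_group_def by blast
  then obtain S where S: "\<And>v. v \<in> verts \<Gamma> \<Longrightarrow> finite (S v)" "\<And>v. v \<in> verts \<Gamma> \<Longrightarrow> S v \<subseteq> carrier (vgrp v)"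
    "\<And>v. v \<in> verts \<Gamma> \<Longrightarrow> generate (vgrp v) (S v) = carrier (vgrp v)"
    by metis
  let ?Z = "\<Union>v\<in>verts \<Gamma>. vert_elt v ` S v"
  have Z: "?Z \<subseteq> carrier PI" using S(2) hom_in_carrier[OF vert_elt_hom] by blast
  have vert: "vert_elt v a \<in> generate PI ?Z" if "v \<in> verts \<Gamma>" "a \<in> carrier (vgrp v)" for v a
  proof -
    have "vert_elt v a \<in> generate PI (vert_elt v ` S v)"
      using group_hom.generate_img[OF vert_elt_group_hom S(2)] S(3) that by auto
    then show ?thesis using PI.mono_generate[of "vert_elt v ` S v" ?Z] that by blast
  qed
  have "x \<in> generate PI ?Z" if "x \<in> carrier PI" for x
    using that by (induction rule: PI_induct) (auto intro: generate.one generate.eng vert)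
  then show ?thesis
    unfolding finitely_generated_group_def using Z S(1) PI.generate_incl[OF Z]
    by (intro conjI exI[of _ ?Z] PI.group_axioms) auto
qed

text \<open>Since \<open>\<alpha> (arev e)\<close> is injective, the restriction of
  \<open>\<chi>\<close> to the edge group can be read as a character of the image of that group at
  the head, and it extends from there.\<close>

lemma character_across_edge:
  assumes D: "root_closed D" and e: "e \<in> arcs \<Gamma>" and \<chi>: "\<chi> \<in> hom (vgrp (tail \<Gamma> e)) (cgrp D)"
  obtains \<chi>' where "\<chi>' \<in> hom (vgrp (head \<Gamma> e)) (cgrp D)"
    "\<And>c. c \<in> carrier (egrp e) \<Longrightarrow> \<chi> (\<alpha> e c) = \<chi>' (\<alpha> (arev e) c)"
proof -
  interpret D: root_closed D by fact
  let ?B = "vgrp (head \<Gamma> e)" and ?C = "\<alpha> (arev e) ` carrier (egrp e)"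
  let ?i = "inv_into (carrier (egrp e)) (\<alpha> (arev e))"
  have mon: "\<alpha> (arev e) \<in> mon (egrp e) ?B" using mon_\<alpha>[of "arev e"] e egrp_arev by simp
  interpret E: group "egrp e" using group_egrp e .
  interpret B: group ?B using group_vgrp e by simp
  interpret a: group_hom "egrp e" ?B "\<alpha> (arev e)"
    using mon by unfold_locales (simp add: mon_def)
  have inj: "inj_on (\<alpha> (arev e)) (carrier (egrp e))" using mon by (simp add: mon_def)
  have C: "subgroup ?C ?B" by (rule a.img_is_subgroup)
  have "(\<chi> \<circ> \<alpha> e \<circ> ?i) \<in> hom (?B\<lparr>carrier := ?C\<rparr>) (cgrp D)"
  proof (rule homI)
    fix x assume "x \<in> carrier (?B\<lparr>carrier := ?C\<rparr>)"
    then show "(\<chi> \<circ> \<alpha> e \<circ> ?i) x \<in> carrier (cgrp D)"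
      using inj hom_in_carrier[OF \<chi>] \<alpha>_closed[OF e] by auto
  next
    fix x y assume "x \<in> carrier (?B\<lparr>carrier := ?C\<rparr>)" "y \<in> carrier (?B\<lparr>carrier := ?C\<rparr>)"
    then obtain c d where cd: "c \<in> carrier (egrp e)" "d \<in> carrier (egrp e)"
      "x = \<alpha> (arev e) c" "y = \<alpha> (arev e) d" by auto
    have "?i (x \<otimes>\<^bsub>?B\<^esub> y) = c \<otimes>\<^bsub>egrp e\<^esub> d"
      using inj cd by (metis E.m_closed a.hom_mult inv_into_f_f)
    then show "(\<chi> \<circ> \<alpha> e \<circ> ?i) (x \<otimes>\<^bsub>?B\<lparr>carrier := ?C\<rparr>\<^esub> y) = (\<chi> \<circ> \<alpha> e \<circ> ?i) x \<otimes>\<^bsub>cgrp D\<^esub> (\<chi> \<circ> \<alpha> e \<circ> ?i) y"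
      using cd inj hom_mult[OF \<alpha>_hom[OF e]] hom_mult[OF \<chi>] \<alpha>_closed[OF e] by simp
  qed
  then obtain \<chi>' where "\<chi>' \<in> hom ?B (cgrp D)" "\<And>c. c \<in> ?C \<Longrightarrow> \<chi>' c = (\<chi> \<circ> \<alpha> e \<circ> ?i) c"
    by (rule D.extend_character[OF comm_vgrp fin_gen_vgrp C, rotated 2]) (use e in auto)
  then show ?thesis using that[of \<chi>'] inj by simp
qed

lemma extend_character_PI:
  assumes D: "root_closed D" and v: "v \<in> verts \<Gamma>" and \<chi>: "\<chi> \<in> hom (vgrp v) (cgrp D)"
  obtains \<Phi> where "\<Phi> \<in> hom PI (cgrp D)" "\<And>a. a \<in> carrier (vgrp v) \<Longrightarrow> \<Phi> (vert_elt v a) = \<chi> a"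
proof -
  interpret D: root_closed D by fact
  obtain \<phi> where "\<phi> v = \<chi>" "\<And>w. w \<in> verts \<Gamma> \<Longrightarrow> \<phi> w \<in> hom (vgrp w) (cgrp D)"
    "\<And>e. e \<in> arcs \<Gamma> \<Longrightarrow> \<forall>c\<in>carrier (egrp e). \<phi> (tail \<Gamma> e) (\<alpha> e c) = \<phi> (head \<Gamma> e) (\<alpha> (arev e) c)"
  proof (rule serre_tree_family[OF tree finite_verts v,
        where Q = "\<lambda>w \<chi>. \<chi> \<in> hom (vgrp w) (cgrp D)"
          and R = "\<lambda>e \<chi> \<chi>'. \<forall>c\<in>carrier (egrp e). \<chi> (\<alpha> e c) = \<chi>' (\<alpha> (arev e) c)", OF \<chi>])
    show "\<exists>y. y \<in> hom (vgrp (head \<Gamma> e)) (cgrp D) \<and> (\<forall>c\<in>carrier (egrp e). x (\<alpha> e c) = y (\<alpha> (arev e) c))"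
      if "e \<in> arcs \<Gamma>" "x \<in> hom (vgrp (tail \<Gamma> e)) (cgrp D)" for e x
      by (rule character_across_edge[OF D that]) blast
  qed (auto simp: egrp_arev)
  then show ?thesis using PI_hom[OF D.cgrp.is_group, of \<phi>] that v by metis
qed

lemma virtual_retract_elliptic:
  assumes v: "v \<in> verts \<Gamma>" "a \<in> carrier (vgrp v)"
    and x: "x \<in> carrier PI" and g: "g = x \<otimes>\<^bsub>PI\<^esub> vert_elt v a \<otimes>\<^bsub>PI\<^esub> inv\<^bsub>PI\<^esub> x"
  shows "virtual_retract PI (range (\<lambda>k::int. g [^]\<^bsub>PI\<^esub> k))"
proof -
  interpret V: comm_group "vgrp v" using comm_vgrp v by simp
  interpret h: group_hom "vgrp v" PI "vert_elt v" using vert_elt_group_hom v by simp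
  obtain h :: complex where h: "h \<noteq> 0" "\<And>k::int. h powi k = 1 \<longleftrightarrow> a [^]\<^bsub>vgrp v\<^esub> k = \<one>\<^bsub>vgrp v\<^esub>"
    using V.ex_complex_same_order[OF v(2)] by blast
  interpret D: root_closed "radical_hull h" by (rule root_closed_radical_hull) fact
  \<comment> \<open>Starting from the trivial subgroup, \<open>a\<close> may be sent to
    \<open>h\<close> because \<open>h^k = 1\<close> whenever \<open>a^k\<close> is trivial.\<close>
  have triv: "(\<lambda>_. 1) \<in> hom (vgrp v\<lparr>carrier := {\<one>\<^bsub>vgrp v\<^esub>}\<rparr>) (cgrp (radical_hull h))"
    by (rule homI) (auto simp: D.one_D)
  have "h \<in> radical_hull h" using powi_in_radical_hull[OF h(1), of 1] by simp
  from D.extend_character_by_element[OF V.comm_group_axioms V.triv_subgroup triv v(2) this]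
  obtain C \<chi> where C: "subgroup C (vgrp v)" "a \<in> C" "\<chi> a = h"
    "\<chi> \<in> hom (vgrp v\<lparr>carrier := C\<rparr>) (cgrp (radical_hull h))"
    using h(2) by (metis singletonD)
  obtain \<chi>' where \<chi>': "\<chi>' \<in> hom (vgrp v) (cgrp (radical_hull h))" "\<chi>' a = h"
    using D.extend_character[OF V.comm_group_axioms fin_gen_vgrp[OF v(1)] C(1,4)] C(2,3) by metis
  obtain \<Phi> where \<Phi>: "\<Phi> \<in> hom PI (cgrp (radical_hull h))" "\<Phi> (vert_elt v a) = h"
    using extend_character_PI[OF D.root_closed_axioms v(1) \<chi>'(1)] v(2) \<chi>'(2) by metis
  interpret \<Phi>: group_hom PI "cgrp (radical_hull h)" \<Phi> using \<Phi>(1) by unfold_locales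
  have a: "vert_elt v a \<in> carrier PI" using v by simp
  then have gc: "g \<in> carrier PI" using g x by simp
  have "\<Phi> x \<noteq> 0" using \<Phi>.hom_closed[OF x] D.nonzero_D by simp
  \<comment> \<open>The target is commutative, so the conjugation by \<open>x\<close>
    disappears.\<close>
  then have "\<Phi> g = h" using g x a \<Phi>(2) \<Phi>.hom_closed[OF x] by (simp add: D.cgrp_inv)
  moreover have "g [^]\<^bsub>PI\<^esub> k = \<one>\<^bsub>PI\<^esub>" if "h powi k = 1" for k :: int
  proof -
    have "vert_elt v a [^]\<^bsub>PI\<^esub> k = \<one>\<^bsub>PI\<^esub>" using that h(2) v(2) by (simp flip: h.hom_int_pow)
    then show ?thesis using g x a by (simp add: PI.int_pow_conjugate)
  qed
  ultimately show ?thesis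
    using PI.virtual_retract_of_character[OF finitely_generated_PI h(1) \<Phi>(1) gc] by blast
qed

end

section \<open>Periodic permutations\<close>

text \<open>\<open>K\<close> is the setwise stabilizer of the shift orbit of \<open>y\<close>. As
  shifts act freely, each element of \<open>K\<close> has a unique displacement, which is additive
  because the action commutes with shifts. The index is finite because \<open>q\<close> takes
  finitely many values on the orbit of \<open>y\<close>, and equal values mean equal shift
  orbits.\<close>

lemma (in group) virtual_retract_of_action:
  fixes \<Phi> :: "'a \<Rightarrow> 'y \<Rightarrow> 'y" and S :: "int \<Rightarrow> 'y \<Rightarrow> 'y" and q :: "'y \<Rightarrow> 'q"
  assumes one: "\<Phi> \<one> = id"
    and mult: "\<And>x z. x \<in> carrier G \<Longrightarrow> z \<in> carrier G \<Longrightarrow> \<Phi> (x \<otimes> z) = \<Phi> x \<circ> \<Phi> z"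
    and comm: "\<And>x m p. x \<in> carrier G \<Longrightarrow> \<Phi> x (S m p) = S m (\<Phi> x p)"
    and S0: "\<And>p. S 0 p = p" and Sadd: "\<And>m k p. S (m + k) p = S m (S k p)"
    and free: "\<And>m k p. S m p = S k p \<Longrightarrow> m = k"
    and fin: "finite F" "\<And>x. x \<in> carrier G \<Longrightarrow> q (\<Phi> x y) \<in> F"
    and q: "\<And>p p'. q p = q p' \<Longrightarrow> \<exists>m. p = S m p'"
    and g: "g \<in> carrier G" "\<Phi> g y = S (- 1) y"
  shows "virtual_retract G (range (\<lambda>k::int. g [^] k))"
proof -
  define K where "K = {x \<in> carrier G. \<exists>m. \<Phi> x y = S m y}"
  \<comment> \<open>The sign gives \<open>E g = 1\<close>, as \<open>g\<close> moves
    \<open>y\<close> by the shift -1.\<close>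
  define E where "E x = - (THE m. \<Phi> x y = S m y)" for x
  have E: "E x = - m" if "\<Phi> x y = S m y" for x m
    unfolding E_def using that free by (metis (mono_tags, lifting) the_equality)
  have mulS: "\<Phi> (x \<otimes> z) y = S (m + k) y"
    if "x \<in> carrier G" "z \<in> carrier G" "\<Phi> x y = S m y" "\<Phi> z y = S k y" for x z m k
    using that by (simp add: mult comm Sadd add.commute[of m k])
  have inv: "\<Phi> (inv x) (\<Phi> x p) = p" "\<Phi> x (\<Phi> (inv x) p) = p" if "x \<in> carrier G" for x p
  proof -
    have "\<Phi> (inv x) \<circ> \<Phi> x = id" "\<Phi> x \<circ> \<Phi> (inv x) = id"
      using that one mult[of "inv x" x] mult[of x "inv x"] by simp_all
    then show "\<Phi> (inv x) (\<Phi> x p) = p" "\<Phi> x (\<Phi> (inv x) p) = p" by (metis comp_apply id_apply)+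
  qed
  have neg: "S (- m) (S m p) = p" for m p using Sadd[of "- m" m p] S0 by simp
  have invS: "\<Phi> (inv x) y = S (- m) y" if "x \<in> carrier G" "\<Phi> x y = S m y" for x m
  proof -
    have "S m (\<Phi> (inv x) y) = y" using that inv(1)[OF that(1), of y] comm[of "inv x" m y] by simp
    then show ?thesis using neg by metis
  qed
  have K: "subgroup K G"
  proof (rule subgroupI)
    have "\<Phi> \<one> y = S 0 y" using one S0 by simp
    then show "K \<noteq> {}" unfolding K_def by blast
    show "inv a \<in> K" if "a \<in> K" for a using that invS unfolding K_def by blast
    show "a \<otimes> b \<in> K" if "a \<in> K" "b \<in> K" for a b using that mulS unfolding K_def by blast
  qed (auto simp: K_def)
  have "finite (rcosets K)"
  \<comment> \<open>A right coset of \<open>K\<close> is determined by the shift orbit of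
    \<open>x^(-1) y\<close>, hence the inverse.\<close>
  proof (rule finite_rcosetsI[OF K, of "\<lambda>x. q (\<Phi> (inv x) y)"])
    show "finite ((\<lambda>x. q (\<Phi> (inv x) y)) ` carrier G)"
      using fin by (auto intro: finite_subset[of _ F])
    fix x z assume xz: "x \<in> carrier G" "z \<in> carrier G" "q (\<Phi> (inv x) y) = q (\<Phi> (inv z) y)"
    then obtain m where "\<Phi> (inv x) y = S m (\<Phi> (inv z) y)" using q by blast
    then have "\<Phi> (inv z) y = S (- m) (\<Phi> (inv x) y)" using neg by simp
    then have "\<Phi> (x \<otimes> inv z) y = S (- m) y" using xz by (simp add: mult comm inv)
    then show "x \<otimes> inv z \<in> K" using xz unfolding K_def by blast
  qed
  moreover have "g \<in> K" using g unfolding K_def by blast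
  moreover have "g [^] E (x \<otimes> z) = g [^] (E x + E z)" if xz: "x \<in> K" "z \<in> K" for x z
  proof -
    obtain m k where "x \<in> carrier G" "\<Phi> x y = S m y" "z \<in> carrier G" "\<Phi> z y = S k y"
      using xz by (auto simp: K_def)
    then have "E (x \<otimes> z) = E x + E z" using E[of x m] E[of z k] E[OF mulS[of x z m k]] by simp
    then show ?thesis by simp
  qed
  moreover have "g [^] E g = g" using E[OF g(2)] g(1) by (simp add: int_pow_1)
  ultimately show ?thesis using virtual_retract_powersI[OF K] by blast
qed

text \<open>The permutations act on the whole type, so that composition and \<open>id\<close> are
  the group operations. Invariance of \<open>R \<times> UNIV\<close> confines orbits to a set that
  has finitely many shift orbits when \<open>R\<close> is finite and \<open>N\<close> is
  positive.\<close>

definition periodic_perms :: "int \<Rightarrow> 'a set \<Rightarrow> ('a \<times> int \<Rightarrow> 'a \<times> int) monoid" where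
  "periodic_perms N R =
     \<lparr>carrier = {f. bij f \<and> (\<forall>x j m. f (x, j + m * N) = map_prod id (\<lambda>i. i + m * N) (f (x, j))) \<and>
        (\<forall>p. f p \<in> R \<times> UNIV \<longleftrightarrow> p \<in> R \<times> UNIV)},
      monoid.mult = (\<circ>), one = id\<rparr>"

lemma periodic_perms_simps [simp]:
  "f \<otimes>\<^bsub>periodic_perms N R\<^esub> g = f \<circ> g" "\<one>\<^bsub>periodic_perms N R\<^esub> = id"
  by (simp_all add: periodic_perms_def)

lemma periodic_permsI:
  assumes "bij f" "\<And>x j m. f (x, j + m * N) = map_prod id (\<lambda>i. i + m * N) (f (x, j))"
    "\<And>p. f p \<in> R \<times> UNIV \<longleftrightarrow> p \<in> R \<times> UNIV"
  shows "f \<in> carrier (periodic_perms N R)"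
  using assms by (simp add: periodic_perms_def)

lemma periodic_permsD:
  assumes "f \<in> carrier (periodic_perms N R)"
  shows "bij f" "f (x, j + m * N) = map_prod id (\<lambda>i. i + m * N) (f (x, j))"
    "f p \<in> R \<times> UNIV \<longleftrightarrow> p \<in> R \<times> UNIV"
  using assms unfolding periodic_perms_def by (cases p; simp)+

lemma periodic_perms_inv_closed:
  assumes f: "f \<in> carrier (periodic_perms N R)"
  shows "inv_into UNIV f \<in> carrier (periodic_perms N R)"
proof (rule periodic_permsI)
  note D = periodic_permsD[OF f]
  have f': "f (inv_into UNIV f p) = p" for p using D(1) by (simp add: bij_is_surj surj_f_inv_f)
  show "bij (inv_into UNIV f)" using D(1) by (rule bij_imp_bij_inv)
  show "inv_into UNIV f p \<in> R \<times> UNIV \<longleftrightarrow> p \<in> R \<times> UNIV" for p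
    using D(3)[of "inv_into UNIV f p"] f' by simp
  fix x j m
  obtain y i where yi: "inv_into UNIV f (x, j) = (y, i)" by fastforce
  have "f (y, i + m * N) = (x, j + m * N)" using D(2)[of y i m] f'[of "(x, j)"] yi by simp
  then show "inv_into UNIV f (x, j + m * N) = map_prod id (\<lambda>i. i + m * N) (inv_into UNIV f (x, j))"
    using D(1) yi by (metis bij_is_inj id_apply inv_f_f map_prod_simp)
qed

lemma group_periodic_perms: "group (periodic_perms N R)"
proof (rule groupI)
  show "\<one>\<^bsub>periodic_perms N R\<^esub> \<in> carrier (periodic_perms N R)" by (auto intro: periodic_permsI)
  fix f assume f: "f \<in> carrier (periodic_perms N R)"
  have "inv_into UNIV f \<circ> f = id" using periodic_permsD(1)[OF f] by (simp add: bij_is_inj)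
  then show "\<exists>g\<in>carrier (periodic_perms N R). g \<otimes>\<^bsub>periodic_perms N R\<^esub> f = \<one>\<^bsub>periodic_perms N R\<^esub>"
    using periodic_perms_inv_closed[OF f] by auto
  fix g assume g: "g \<in> carrier (periodic_perms N R)"
  show "f \<otimes>\<^bsub>periodic_perms N R\<^esub> g \<in> carrier (periodic_perms N R)"
  proof (rule periodic_permsI)
    show "bij (f \<otimes>\<^bsub>periodic_perms N R\<^esub> g)" using bij_comp[OF periodic_permsD(1)[OF g] periodic_permsD(1)[OF f]] by simp
    show "(f \<otimes>\<^bsub>periodic_perms N R\<^esub> g) p \<in> R \<times> UNIV \<longleftrightarrow> p \<in> R \<times> UNIV" for p
      using periodic_permsD(3)[OF f] periodic_permsD(3)[OF g] by simp
    show "(f \<otimes>\<^bsub>periodic_perms N R\<^esub> g) (x, j + m * N) =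
      map_prod id (\<lambda>i. i + m * N) ((f \<otimes>\<^bsub>periodic_perms N R\<^esub> g) (x, j))" for x j m
      using periodic_permsD(2)[OF g, of x j m] periodic_permsD(2)[OF f]
      by (cases "g (x, j)") simp
  qed
qed auto

lemma periodic_perms_inv:
  "f \<in> carrier (periodic_perms N R) \<Longrightarrow> inv\<^bsub>periodic_perms N R\<^esub> f = inv_into UNIV f"
  using periodic_perms_inv_closed[of f N R] periodic_permsD(1)[of f N R]
  by (intro group.inv_equality[OF group_periodic_perms]) (auto simp: bij_is_inj)

text \<open>Level \<open>j\<close> and level \<open>j + 1\<close> of \<open>R \<times> \<int>\<close> are glued along the single \<open>D (\<sigma> j)\<close>-orbits of
  \<open>1\<close> and of \<open>b j\<close>. The condition \<open>reduced\<close> keeps the two orbits used at a level by the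
  same label apart, so that all the swaps with a given label form one involution.\<close>

locale swap_system =
  fixes N :: int and R :: "'a::comm_monoid_mult set" and b b' :: "int \<Rightarrow> 'a"
    and \<sigma> :: "int \<Rightarrow> 's" and D :: "'s \<Rightarrow> 'a set"
  assumes bb': "b j * b' j = 1"
    and periodic: "\<sigma> (j + m * N) = \<sigma> j" "b (j + m * N) = b j" "b' (j + m * N) = b' j"
    and R_mult: "x \<in> R \<Longrightarrow> y \<in> R \<Longrightarrow> x * y \<in> R" and b_R: "b j \<in> R" "b' j \<in> R"
    and D_one: "1 \<in> D s" and D_mult: "x \<in> D s \<Longrightarrow> y \<in> D s \<Longrightarrow> x * y \<in> D s"
    and D_inv: "x \<in> D s \<Longrightarrow> \<exists>y\<in>D s. y * x = 1"
    and reduced: "\<sigma> (j + 1) = \<sigma> j \<Longrightarrow> b j \<notin> D (\<sigma> j)"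
begin

text \<open>The first branch climbs from the orbit of 1 at level \<open>j\<close>. The second is its
  inverse, seen from the upper of the two levels.\<close>

definition \<tau> :: "'s \<Rightarrow> 'a \<times> int \<Rightarrow> 'a \<times> int" where
  "\<tau> s = (\<lambda>(x, j). if \<sigma> j = s \<and> x \<in> D s then (x * b j, j + 1)
     else if \<sigma> (j - 1) = s \<and> x * b' (j - 1) \<in> D s then (x * b' (j - 1), j - 1) else (x, j))"

lemma D_cancel:
  assumes "d \<in> D s" shows "d * x \<in> D s \<longleftrightarrow> x \<in> D s"
proof
  obtain e where e: "e \<in> D s" "e * d = 1" using D_inv[OF assms] by blast
  assume "d * x \<in> D s"
  then have "e * (d * x) \<in> D s" using e D_mult by blast
  then show "x \<in> D s" using e by (simp flip: mult.assoc)
qed (use D_mult assms in blast)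

lemma b_cancel: "x * b j * b' j = x" "x * b' j * b j = x"
  using bb'[of j] by (simp_all add: mult.assoc mult.commute[of "b' j"])

lemma \<tau>_\<tau>: "\<tau> s (\<tau> s p) = p"
proof (cases p)
  case (Pair x j)
  consider "\<sigma> j = s" "x \<in> D s"
    | "\<not> (\<sigma> j = s \<and> x \<in> D s)" "\<sigma> (j - 1) = s" "x * b' (j - 1) \<in> D s"
    | "\<not> (\<sigma> j = s \<and> x \<in> D s)" "\<not> (\<sigma> (j - 1) = s \<and> x * b' (j - 1) \<in> D s)" by blast
  then show ?thesis
  proof cases
    case 1
    \<comment> \<open>After climbing, the point must not be caught by the first branch again one
      level higher: if that level has the same label, the orbit of \<open>b j\<close> misses
      \<open>D s\<close> by \<open>reduced\<close>.\<close>
    have "\<not> (\<sigma> (j + 1) = s \<and> x * b j \<in> D s)" using reduced[of j] 1 D_cancel[of x s] by auto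
    then show ?thesis using 1 Pair b_cancel by (simp add: \<tau>_def)
  qed (use Pair b_cancel in \<open>auto simp: \<tau>_def\<close>)
qed

text \<open>The swapped sets are \<open>D s\<close>-orbits and the swap is a multiplication, so it
  commutes with \<open>D s\<close>. This later makes the vertex actions agree on edge
  groups.\<close>

lemma \<tau>_equivariant:
  assumes "d \<in> D s" shows "\<tau> s (d * x, j) = map_prod ((*) d) id (\<tau> s (x, j))"
  using D_cancel[OF assms] by (simp add: \<tau>_def mult.assoc)

text \<open>By this the walk descends one level. The assumption \<open>reduced\<close> keeps the
  point out of the first branch, which would send it up.\<close>

lemma \<tau>_step: "\<tau> (\<sigma> j) (b j, j + 1) = (1, j)"
  using reduced[of j] by (auto simp: \<tau>_def bb' D_one)

lemma \<tau>_in_R: "p \<in> R \<times> UNIV \<Longrightarrow> \<tau> s p \<in> R \<times> UNIV"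
  by (auto simp: \<tau>_def R_mult b_R)

lemma \<tau>_periodic_perms: "\<tau> s \<in> carrier (periodic_perms N R)"
proof (rule periodic_permsI)
  show "bij (\<tau> s)" by (rule o_bij[of "\<tau> s"]) (auto simp: \<tau>_\<tau>)
  show "\<tau> s p \<in> R \<times> UNIV \<longleftrightarrow> p \<in> R \<times> UNIV" for p
    using \<tau>_in_R[of p s] \<tau>_in_R[of "\<tau> s p" s] by (auto simp: \<tau>_\<tau>)
  have "\<sigma> (j + m * N - 1) = \<sigma> (j - 1)" "b' (j + m * N - 1) = b' (j - 1)" for j m
    using periodic(1,3)[of "j - 1" m] by (simp_all add: algebra_simps)
  then show "\<tau> s (x, j + m * N) = map_prod id (\<lambda>i. i + m * N) (\<tau> s (x, j))" for x j m
    using periodic by (simp add: \<tau>_def)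
qed

end

section \<open>Cyclically reduced walks\<close>

context abelian_tree
begin

text \<open>A labelled walk \<open>(e\<^sub>1, a\<^sub>1), \<dots>, (e\<^sub>n, a\<^sub>n)\<close> carries an element \<open>a\<^sub>i\<close> of the group at the head of \<open>e\<^sub>i\<close>.\<close>

fun lwalk :: "'v \<Rightarrow> ('e \<times> 'g) list \<Rightarrow> 'v \<Rightarrow> bool" where
  "lwalk u [] v \<longleftrightarrow> u = v \<and> u \<in> verts \<Gamma>"
| "lwalk u ((e, a) # w) v \<longleftrightarrow>
     e \<in> arcs \<Gamma> \<and> tail \<Gamma> e = u \<and> a \<in> carrier (vgrp (head \<Gamma> e)) \<and> lwalk (head \<Gamma> e) w v"

fun lval :: "('e \<times> 'g) list \<Rightarrow> ('v, 'g, 'e) gog_gen gword set" where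
  "lval [] = \<one>\<^bsub>PI\<^esub>"
| "lval ((e, a) # w) = vert_elt (head \<Gamma> e) a \<otimes>\<^bsub>PI\<^esub> lval w"

definition cyc_reduced :: "('e \<times> 'g) list \<Rightarrow> bool" where
  "cyc_reduced w \<longleftrightarrow> (\<forall>i<length w. fst (w ! (Suc i mod length w)) = arev (fst (w ! i)) \<longrightarrow>
     snd (w ! i) \<notin> \<alpha> (arev (fst (w ! i))) ` carrier (egrp (fst (w ! i))))"

lemma vert_elt_closed [simp]: "v \<in> verts \<Gamma> \<Longrightarrow> a \<in> carrier (vgrp v) \<Longrightarrow> vert_elt v a \<in> carrier PI"
  by (rule hom_in_carrier[OF vert_elt_hom])

lemma vert_elt_mult:
  "v \<in> verts \<Gamma> \<Longrightarrow> a \<in> carrier (vgrp v) \<Longrightarrow> b \<in> carrier (vgrp v) \<Longrightarrow>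
    vert_elt v a \<otimes>\<^bsub>PI\<^esub> vert_elt v b = vert_elt v (a \<otimes>\<^bsub>vgrp v\<^esub> b)"
  by (rule hom_mult[OF vert_elt_hom, symmetric])

lemma vert_elt_one: "v \<in> verts \<Gamma> \<Longrightarrow> vert_elt v \<one>\<^bsub>vgrp v\<^esub> = \<one>\<^bsub>PI\<^esub>"
  by (rule hom_one[OF vert_elt_hom group_vgrp PI.group_axioms])

lemma vgrp_one: "v \<in> verts \<Gamma> \<Longrightarrow> \<one>\<^bsub>vgrp v\<^esub> \<in> carrier (vgrp v)"
  by (intro monoid.one_closed group.is_monoid group_vgrp)

lemma vgrp_mult: "v \<in> verts \<Gamma> \<Longrightarrow> a \<in> carrier (vgrp v) \<Longrightarrow> b \<in> carrier (vgrp v) \<Longrightarrow> a \<otimes>\<^bsub>vgrp v\<^esub> b \<in> carrier (vgrp v)"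
  by (intro monoid.m_closed group.is_monoid group_vgrp)

section \<open>Group elements as values of labelled walks\<close>

lemma lwalk_verts: "lwalk u w v \<Longrightarrow> u \<in> verts \<Gamma> \<and> v \<in> verts \<Gamma>"
  by (induction u w v rule: lwalk.induct) auto

lemma lwalk_append: "lwalk u (w @ w') v \<longleftrightarrow> (\<exists>z. lwalk u w z \<and> lwalk z w' v)"
proof (induction w arbitrary: u)
  case Nil then show ?case using lwalk_verts by auto
next
  case (Cons p w) then show ?case by (cases p) auto
qed

lemma lval_closed: "lwalk u w v \<Longrightarrow> lval w \<in> carrier PI"
  by (induction u w v rule: lwalk.induct) auto

lemma lval_append:
  "lwalk u w v \<Longrightarrow> lwalk v w' z \<Longrightarrow> lval (w @ w') = lval w \<otimes>\<^bsub>PI\<^esub> lval w'"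
  by (induction u w v rule: lwalk.induct) (auto simp: PI.m_assoc lval_closed)

text \<open>\<open>lval\<close> has labels at the heads of arcs only; the additional factor supplies
  one at the start vertex.\<close>

definition walk_elts :: "'v \<Rightarrow> 'v \<Rightarrow> ('v, 'g, 'e) gog_gen gword set set" where
  "walk_elts u v = {vert_elt u a \<otimes>\<^bsub>PI\<^esub> lval w | a w. a \<in> carrier (vgrp u) \<and> lwalk u w v}"

lemma walk_eltsI:
  "x = vert_elt u a \<otimes>\<^bsub>PI\<^esub> lval w \<Longrightarrow> a \<in> carrier (vgrp u) \<Longrightarrow> lwalk u w v \<Longrightarrow> x \<in> walk_elts u v"
  unfolding walk_elts_def by blast

lemma walk_elts_vert_elt:
  assumes "x \<in> walk_elts u v" "b \<in> carrier (vgrp v)"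
  shows "x \<otimes>\<^bsub>PI\<^esub> vert_elt v b \<in> walk_elts u v"
proof -
  obtain a w where x: "x = vert_elt u a \<otimes>\<^bsub>PI\<^esub> lval w" and a: "a \<in> carrier (vgrp u)" and w: "lwalk u w v"
    using assms(1) by (auto simp: walk_elts_def)
  have uv: "u \<in> verts \<Gamma>" "v \<in> verts \<Gamma>" using lwalk_verts[OF w] by auto
  show ?thesis
  proof (cases w rule: rev_cases)
    case Nil
    then have "x \<otimes>\<^bsub>PI\<^esub> vert_elt v b = vert_elt u (a \<otimes>\<^bsub>vgrp u\<^esub> b) \<otimes>\<^bsub>PI\<^esub> lval []" "u = v"
      using x a w uv assms(2) by (auto simp: vert_elt_mult vgrp_mult)
    moreover have "a \<otimes>\<^bsub>vgrp u\<^esub> b \<in> carrier (vgrp u)" "lwalk u [] v"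
      using \<open>u = v\<close> a uv assms(2) vgrp_mult by auto
    ultimately show ?thesis using walk_eltsI by blast
  next
    case (snoc w' p)
    obtain e c where p: "p = (e, c)" by fastforce
    obtain z where z: "lwalk u w' z" "e \<in> arcs \<Gamma>" "tail \<Gamma> e = z" "c \<in> carrier (vgrp v)" "head \<Gamma> e = v"
      using w snoc p by (auto simp: lwalk_append)
    let ?w = "w' @ [(e, c \<otimes>\<^bsub>vgrp v\<^esub> b)]"
    have 1: "lwalk z [(e, c)] v" "lwalk z [(e, c \<otimes>\<^bsub>vgrp v\<^esub> b)] v"
      using z uv assms(2) vgrp_mult by auto
    then have w': "lwalk u ?w v" using z(1) lwalk_append by blast
    have "lval w = lval w' \<otimes>\<^bsub>PI\<^esub> vert_elt v c" "lval ?w = lval w' \<otimes>\<^bsub>PI\<^esub> (vert_elt v c \<otimes>\<^bsub>PI\<^esub> vert_elt v b)"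
      using lval_append[OF z(1) 1(1)] lval_append[OF z(1) 1(2)] snoc p z uv assms(2)
      by (simp_all add: vert_elt_mult vgrp_mult)
    then have "x \<otimes>\<^bsub>PI\<^esub> vert_elt v b = vert_elt u a \<otimes>\<^bsub>PI\<^esub> lval ?w"
      using x a uv z assms(2) lval_closed[OF z(1)] by (simp add: PI.m_assoc)
    then show ?thesis using a w' by (rule walk_eltsI)
  qed
qed

lemma walk_elts_mult:
  assumes "x \<in> walk_elts u v" "y \<in> walk_elts v z"
  shows "x \<otimes>\<^bsub>PI\<^esub> y \<in> walk_elts u z"
proof -
  obtain b w' where y: "y = vert_elt v b \<otimes>\<^bsub>PI\<^esub> lval w'" and b: "b \<in> carrier (vgrp v)" and w': "lwalk v w' z"
    using assms(2) by (auto simp: walk_elts_def)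
  obtain a w where x: "x \<otimes>\<^bsub>PI\<^esub> vert_elt v b = vert_elt u a \<otimes>\<^bsub>PI\<^esub> lval w" and a: "a \<in> carrier (vgrp u)"
    and w: "lwalk u w v"
    using walk_elts_vert_elt[OF assms(1) b] by (auto simp: walk_elts_def)
  have uv: "u \<in> verts \<Gamma>" "v \<in> verts \<Gamma>" using lwalk_verts[OF w] by auto
  have xc: "x \<in> carrier PI" using assms(1) lwalk_verts lval_closed by (fastforce simp: walk_elts_def)
  have "x \<otimes>\<^bsub>PI\<^esub> y = (x \<otimes>\<^bsub>PI\<^esub> vert_elt v b) \<otimes>\<^bsub>PI\<^esub> lval w'"
    using y xc b uv lval_closed[OF w'] by (simp add: PI.m_assoc)
  also have "\<dots> = vert_elt u a \<otimes>\<^bsub>PI\<^esub> lval (w @ w')"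
    using x a uv lval_closed[OF w] lval_closed[OF w'] lval_append[OF w w'] by (simp add: PI.m_assoc)
  finally show ?thesis by (rule walk_eltsI[OF _ a]) (use w w' lwalk_append in blast)
qed

text \<open>Walks with trivial labels have value 1, so one may travel between any two vertices
  without changing the element.\<close>

lemma one_walk_elts:
  assumes "u \<in> verts \<Gamma>" "v \<in> verts \<Gamma>"
  shows "\<one>\<^bsub>PI\<^esub> \<in> walk_elts u v"
proof -
  have nil: "\<one>\<^bsub>PI\<^esub> \<in> walk_elts x x" if "x \<in> verts \<Gamma>" for x
  proof -
    have "\<one>\<^bsub>PI\<^esub> = vert_elt x \<one>\<^bsub>vgrp x\<^esub> \<otimes>\<^bsub>PI\<^esub> lval []" "lwalk x [] x"
      using that by (auto simp: vert_elt_one)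
    then show ?thesis using walk_eltsI[OF _ vgrp_one[OF that]] by metis
  qed
  have arc: "\<one>\<^bsub>PI\<^esub> \<in> walk_elts (tail \<Gamma> e) (head \<Gamma> e)" if "e \<in> arcs \<Gamma>" for e
  proof -
    have "\<one>\<^bsub>PI\<^esub> = vert_elt (tail \<Gamma> e) \<one>\<^bsub>vgrp (tail \<Gamma> e)\<^esub> \<otimes>\<^bsub>PI\<^esub> lval [(e, \<one>\<^bsub>vgrp (head \<Gamma> e)\<^esub>)]"
      "lwalk (tail \<Gamma> e) [(e, \<one>\<^bsub>vgrp (head \<Gamma> e)\<^esub>)] (head \<Gamma> e)"
      using that by (auto simp: vert_elt_one vgrp_one)
    then show ?thesis using walk_eltsI[OF _ vgrp_one[of "tail \<Gamma> e"]] that by (metis tail_in_verts)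
  qed
  have "u \<rightarrow>\<^sup>*\<^bsub>\<Gamma>\<^esub> v" by (rule connected_reachable[OF connected assms])
  then show ?thesis
  proof (induction rule: reachable_induct)
    case base then show ?case using nil by simp
  next
    case (step x y)
    then obtain e where e: "e \<in> arcs \<Gamma>" "tail \<Gamma> e = x" "head \<Gamma> e = y" by (auto simp: arcs_ends_conv)
    then show ?case using walk_elts_mult[OF step.IH, of "\<one>\<^bsub>PI\<^esub>" y] arc[OF e(1)] by simp
  qed
qed

lemma carrier_walk_elts:
  assumes "g \<in> carrier PI" "r \<in> verts \<Gamma>" shows "g \<in> walk_elts r r"
  using assms(1)
proof (induction rule: PI_induct)
  case one then show ?case using one_walk_elts assms by simp
next
  case (mult v a x)
  have "\<one>\<^bsub>PI\<^esub> \<otimes>\<^bsub>PI\<^esub> vert_elt v a \<in> walk_elts r v"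
    by (rule walk_elts_vert_elt[OF one_walk_elts]) (use mult assms in auto)
  then have "vert_elt v a \<in> walk_elts r v" using mult by simp
  from walk_elts_mult[OF this one_walk_elts] have "vert_elt v a \<in> walk_elts r r"
    using mult assms by simp
  then show ?case using walk_elts_mult mult by blast
qed

text \<open>Moving the first letter to the end conjugates the value by the factor of that letter.
  This brings a backtracking to the front of a closed walk.\<close>

lemma lwalk_rotate:
  assumes "lwalk u w u"
  shows "\<exists>v x. lwalk v (rotate i w) v \<and> x \<in> carrier PI \<and>
    lval w = x \<otimes>\<^bsub>PI\<^esub> lval (rotate i w) \<otimes>\<^bsub>PI\<^esub> inv\<^bsub>PI\<^esub> x"
proof (induction i)
  case 0
  show ?case using assms lval_closed[OF assms] by (auto intro!: exI[of _ u] exI[of _ "\<one>\<^bsub>PI\<^esub>"])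
next
  case (Suc i)
  then obtain v x where v: "lwalk v (rotate i w) v" and x: "x \<in> carrier PI"
    and eq: "lval w = x \<otimes>\<^bsub>PI\<^esub> lval (rotate i w) \<otimes>\<^bsub>PI\<^esub> inv\<^bsub>PI\<^esub> x" by blast
  show ?case
  proof (cases "rotate i w")
    case Nil
    then show ?thesis using v x eq by auto
  next
    case (Cons p w')
    obtain e a where p: "p = (e, a)" by fastforce
    let ?y = "vert_elt (head \<Gamma> e) a"
    have e: "e \<in> arcs \<Gamma>" "tail \<Gamma> e = v" "a \<in> carrier (vgrp (head \<Gamma> e))" and w': "lwalk (head \<Gamma> e) w' v"
      using v Cons p by auto
    have ea: "lwalk v [(e, a)] (head \<Gamma> e)" using e by simp
    have rot: "rotate (Suc i) w = w' @ [(e, a)]" using Cons p by (simp add: rotate_Suc rotate1.simps(2))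
    have y: "?y \<in> carrier PI" using e by simp
    have "lval (rotate (Suc i) w) = lval w' \<otimes>\<^bsub>PI\<^esub> ?y"
      using lval_append[OF w' ea] rot y by simp
    moreover have "lval (rotate i w) = ?y \<otimes>\<^bsub>PI\<^esub> lval w'" using Cons p by simp
    moreover have "?y \<otimes>\<^bsub>PI\<^esub> (inv\<^bsub>PI\<^esub> ?y \<otimes>\<^bsub>PI\<^esub> inv\<^bsub>PI\<^esub> x) = inv\<^bsub>PI\<^esub> x"
      using x y by (simp flip: PI.m_assoc)
    ultimately have "lval w = (x \<otimes>\<^bsub>PI\<^esub> ?y) \<otimes>\<^bsub>PI\<^esub> lval (rotate (Suc i) w) \<otimes>\<^bsub>PI\<^esub> inv\<^bsub>PI\<^esub> (x \<otimes>\<^bsub>PI\<^esub> ?y)"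
      using eq x y lval_closed[OF w'] by (simp add: PI.m_assoc PI.inv_mult_group)
    moreover have "lwalk (head \<Gamma> e) (rotate (Suc i) w) (head \<Gamma> e)"
      unfolding rot lwalk_append using w' ea by blast
    ultimately show ?thesis using x y by blast
  qed
qed

text \<open>The edge element is carried back across its arc and merges with the next label. Two arcs
  disappear at the price of a factor at \<open>u\<close> in front.\<close>

lemma lval_backtrack:
  assumes w: "lwalk u ((e, a) # (arev e, b) # w) u" and a: "a = \<alpha> (arev e) c" "c \<in> carrier (egrp e)"
  shows "lwalk u w u" "\<alpha> e c \<otimes>\<^bsub>vgrp u\<^esub> b \<in> carrier (vgrp u)"
    "lval ((e, a) # (arev e, b) # w) = vert_elt u (\<alpha> e c \<otimes>\<^bsub>vgrp u\<^esub> b) \<otimes>\<^bsub>PI\<^esub> lval w"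
proof -
  have e: "e \<in> arcs \<Gamma>" "tail \<Gamma> e = u" "b \<in> carrier (vgrp u)" and w': "lwalk u w u"
    using w by auto
  have u: "u \<in> verts \<Gamma>" using lwalk_verts[OF w'] by simp
  have \<alpha>c: "\<alpha> e c \<in> carrier (vgrp u)" using \<alpha>_closed[OF e(1) a(2)] e by simp
  show "lwalk u w u" "\<alpha> e c \<otimes>\<^bsub>vgrp u\<^esub> b \<in> carrier (vgrp u)" using w' u \<alpha>c e vgrp_mult by auto
  have "lval ((e, a) # (arev e, b) # w) = vert_elt u (\<alpha> e c) \<otimes>\<^bsub>PI\<^esub> (vert_elt u b \<otimes>\<^bsub>PI\<^esub> lval w)"
    using e a vert_elt_edge[OF e(1) a(2)] by simp
  also have "\<dots> = vert_elt u (\<alpha> e c \<otimes>\<^bsub>vgrp u\<^esub> b) \<otimes>\<^bsub>PI\<^esub> lval w"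
    using u \<alpha>c e lval_closed[OF w'] by (simp add: PI.m_assoc flip: vert_elt_mult)
  finally show "lval ((e, a) # (arev e, b) # w) = vert_elt u (\<alpha> e c \<otimes>\<^bsub>vgrp u\<^esub> b) \<otimes>\<^bsub>PI\<^esub> lval w" .
qed

text \<open>Among all labelled closed walks representing a conjugate of the given element, a shortest
  one has no backtracking.\<close>

lemma conjugate_cases:
  assumes g: "g \<in> carrier PI"
  obtains (elliptic) x v a where "x \<in> carrier PI" "v \<in> verts \<Gamma>" "a \<in> carrier (vgrp v)"
      "g = x \<otimes>\<^bsub>PI\<^esub> vert_elt v a \<otimes>\<^bsub>PI\<^esub> inv\<^bsub>PI\<^esub> x"
    | (hyperbolic) x u w where "x \<in> carrier PI" "lwalk u w u" "w \<noteq> []" "cyc_reduced w"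
      "g = x \<otimes>\<^bsub>PI\<^esub> lval w \<otimes>\<^bsub>PI\<^esub> inv\<^bsub>PI\<^esub> x"
proof -
  have conj_conj: "x \<otimes>\<^bsub>PI\<^esub> (y \<otimes>\<^bsub>PI\<^esub> z \<otimes>\<^bsub>PI\<^esub> inv\<^bsub>PI\<^esub> y) \<otimes>\<^bsub>PI\<^esub> inv\<^bsub>PI\<^esub> x =
      (x \<otimes>\<^bsub>PI\<^esub> y) \<otimes>\<^bsub>PI\<^esub> z \<otimes>\<^bsub>PI\<^esub> inv\<^bsub>PI\<^esub> (x \<otimes>\<^bsub>PI\<^esub> y)"
    if "x \<in> carrier PI" "y \<in> carrier PI" "z \<in> carrier PI" for x y z
    using that by (simp add: PI.m_assoc PI.inv_mult_group)
  \<comment> \<open>A leading factor \<open>a\<close> is allowed because removing a backtracking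
    produces one.\<close>
  define S where "S n \<longleftrightarrow> (\<exists>x u a w. x \<in> carrier PI \<and> a \<in> carrier (vgrp u) \<and> lwalk u w u \<and> length w = n \<and>
    g = x \<otimes>\<^bsub>PI\<^esub> (vert_elt u a \<otimes>\<^bsub>PI\<^esub> lval w) \<otimes>\<^bsub>PI\<^esub> inv\<^bsub>PI\<^esub> x)" for n
  have "verts \<Gamma> \<noteq> {}"
    using connected by (auto simp: Digraph_Component.connected_def strongly_connected_def mk_symmetric_def)
  then obtain r where r: "r \<in> verts \<Gamma>" by blast
  obtain a w where aw: "a \<in> carrier (vgrp r)" "lwalk r w r" "g = vert_elt r a \<otimes>\<^bsub>PI\<^esub> lval w"
    using carrier_walk_elts[OF g r] by (auto simp: walk_elts_def)
  then have "S (length w)"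
    unfolding S_def using g by (intro exI[of _ "\<one>\<^bsub>PI\<^esub>"] exI[of _ r] exI[of _ a] exI[of _ w]) simp
  then have ex: "\<exists>n. S n" by blast
  define n where "n = (LEAST n. S n)"
  have n: "S n" unfolding n_def using ex by (rule LeastI_ex)
  have least: "\<not> S m" if "m < n" for m using that not_less_Least unfolding n_def by blast
  obtain x u a w where x: "x \<in> carrier PI" and a: "a \<in> carrier (vgrp u)" and w: "lwalk u w u"
    and len: "length w = n" and gx: "g = x \<otimes>\<^bsub>PI\<^esub> (vert_elt u a \<otimes>\<^bsub>PI\<^esub> lval w) \<otimes>\<^bsub>PI\<^esub> inv\<^bsub>PI\<^esub> x"
    using n unfolding S_def by blast
  have u: "u \<in> verts \<Gamma>" using lwalk_verts[OF w] by simp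
  show ?thesis
  proof (cases w rule: rev_cases)
    case Nil
    then show ?thesis using elliptic[OF x u a] gx u a by simp
  next
    case (snoc w0 p)
    obtain e b where p: "p = (e, b)" by fastforce
    obtain z where z: "lwalk u w0 z" "e \<in> arcs \<Gamma>" "tail \<Gamma> e = z" "b \<in> carrier (vgrp u)" "head \<Gamma> e = u"
      using w snoc p by (auto simp: lwalk_append)
    \<comment> \<open>Conjugation takes the leading factor to the end of the walk, where it joins
      the last label.\<close>
    define w1 where "w1 = w0 @ [(e, b \<otimes>\<^bsub>vgrp u\<^esub> a)]"
    let ?y = "vert_elt u a"
    have y: "?y \<in> carrier PI" using u a by simp
    have eb: "lwalk z [(e, b)] u" "lwalk z [(e, b \<otimes>\<^bsub>vgrp u\<^esub> a)] u" using z u a vgrp_mult by auto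
    have w1: "lwalk u w1 u" unfolding w1_def lwalk_append using z(1) eb by blast
    have "lval w = lval w0 \<otimes>\<^bsub>PI\<^esub> vert_elt u b" "lval w1 = lval w0 \<otimes>\<^bsub>PI\<^esub> (vert_elt u b \<otimes>\<^bsub>PI\<^esub> ?y)"
      using lval_append[OF z(1) eb(1)] lval_append[OF z(1) eb(2)] snoc p z u a
      by (simp_all add: w1_def vert_elt_mult vgrp_mult)
    then have "?y \<otimes>\<^bsub>PI\<^esub> lval w = ?y \<otimes>\<^bsub>PI\<^esub> lval w1 \<otimes>\<^bsub>PI\<^esub> inv\<^bsub>PI\<^esub> ?y"
      using y z u lval_closed[OF z(1)] by (simp add: PI.m_assoc)
    then have gw1: "g = (x \<otimes>\<^bsub>PI\<^esub> ?y) \<otimes>\<^bsub>PI\<^esub> lval w1 \<otimes>\<^bsub>PI\<^esub> inv\<^bsub>PI\<^esub> (x \<otimes>\<^bsub>PI\<^esub> ?y)"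
      using gx conj_conj[OF x y lval_closed[OF w1]] by simp
    have len1: "length w1 = n" "n > 0" using len snoc by (auto simp: w1_def)
    have "cyc_reduced w1"
      unfolding cyc_reduced_def
    proof (intro allI impI notI)
      fix i assume i: "i < length w1" and bt: "fst (w1 ! (Suc i mod length w1)) = arev (fst (w1 ! i))"
        and im: "snd (w1 ! i) \<in> \<alpha> (arev (fst (w1 ! i))) ` carrier (egrp (fst (w1 ! i)))"
      obtain v t where v: "lwalk v (rotate i w1) v" and t: "t \<in> carrier PI"
        and rot: "lval w1 = t \<otimes>\<^bsub>PI\<^esub> lval (rotate i w1) \<otimes>\<^bsub>PI\<^esub> inv\<^bsub>PI\<^esub> t"
        using lwalk_rotate[OF w1] by blast
      let ?w2 = "rotate i w1"
      have w20: "?w2 ! 0 = w1 ! i" using i len1 by (simp add: nth_rotate)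
      have arcs1: "fst q \<in> arcs \<Gamma>" if "q \<in> set w" "lwalk u w v" for q w u v
        using that by (induction u w v rule: lwalk.induct) auto
      have e1: "fst (w1 ! i) \<in> arcs \<Gamma>" using arcs1[OF nth_mem[OF i] w1] .
      \<comment> \<open>In a walk of one letter the cyclic successor is the same arc, which is never
        its own reverse.\<close>
      have "n \<noteq> 1"
      proof
        assume "n = 1"
        then have "fst (w1 ! i) = arev (fst (w1 ! i))" using bt i len1 by simp
        then show False using arev_neq[OF e1] by simp
      qed
      then have n2: "n \<ge> 2" using len1 by simp
      have w21: "?w2 ! 1 = w1 ! (Suc i mod length w1)" using n2 len1 by (simp add: nth_rotate)
      obtain p0 p1 w3 where w2: "?w2 = p0 # p1 # w3"
        using n2 len1 by (metis One_nat_def Suc_le_length_iff length_rotate numeral_2_eq_2)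
      obtain e1 a1 where p0: "p0 = (e1, a1)" by fastforce
      have w1i: "w1 ! i = (e1, a1)" using w20 w2 p0 by simp
      obtain b1 where p1: "p1 = (arev e1, b1)" using w2 w20 w21 bt p0 by (metis One_nat_def nth_Cons_0 nth_Cons_Suc prod.collapse fst_conv)
      obtain c where c: "a1 = \<alpha> (arev e1) c" "c \<in> carrier (egrp e1)" using im by (auto simp: w1i)
      have v': "lwalk v ((e1, a1) # (arev e1, b1) # w3) v" using v unfolding w2 p0 p1 .
      note bk = lval_backtrack[OF v' c]
      have tc: "x \<otimes>\<^bsub>PI\<^esub> ?y \<otimes>\<^bsub>PI\<^esub> t \<in> carrier PI" using x y t by simp
      have "g = (x \<otimes>\<^bsub>PI\<^esub> ?y \<otimes>\<^bsub>PI\<^esub> t) \<otimes>\<^bsub>PI\<^esub> lval ?w2 \<otimes>\<^bsub>PI\<^esub> inv\<^bsub>PI\<^esub> (x \<otimes>\<^bsub>PI\<^esub> ?y \<otimes>\<^bsub>PI\<^esub> t)"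
        using gw1 rot conj_conj[of "x \<otimes>\<^bsub>PI\<^esub> ?y" t "lval ?w2"] x y t lval_closed[OF v] by simp
      then have "S (length w3)"
        unfolding S_def using tc bk w2 p0 p1 by metis
      moreover have "length w3 < n" using w2 len1 by (metis length_Cons length_rotate less_Suc_eq lessI)
      ultimately show False using least by blast
    qed
    moreover have "w1 \<noteq> []" by (simp add: w1_def)
    moreover have "x \<otimes>\<^bsub>PI\<^esub> ?y \<in> carrier PI" using x y by simp
    ultimately show ?thesis using hyperbolic w1 gw1 by blast
  qed
qed

end

section \<open>Hyperbolic elements\<close>

context abelian_tree
begin

lemma edge_separating_character:
  assumes e: "e \<in> arcs \<Gamma>" and a: "a \<in> carrier (vgrp (head \<Gamma> e))" "a \<notin> \<alpha> (arev e) ` carrier (egrp e)"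
  obtains \<Phi> where "\<Phi> \<in> hom PI (cgrp (radical_hull 1))"
    "\<And>c. c \<in> carrier (egrp e) \<Longrightarrow> \<Phi> (vert_elt (head \<Gamma> e) (\<alpha> (arev e) c)) = 1"
    "\<Phi> (vert_elt (head \<Gamma> e) a) \<noteq> 1"
proof -
  have v: "head \<Gamma> e \<in> verts \<Gamma>" using e by simp
  have "group_hom (egrp e) (vgrp (head \<Gamma> e)) (\<alpha> (arev e))"
    using \<alpha>_hom[of "arev e"] e egrp_arev group_egrp group_vgrp
    by (simp add: group_hom_def group_hom_axioms_def)
  then have C: "subgroup (\<alpha> (arev e) ` carrier (egrp e)) (vgrp (head \<Gamma> e))"
    by (rule group_hom.img_is_subgroup)
  obtain \<chi> where \<chi>: "\<chi> \<in> hom (vgrp (head \<Gamma> e)) (cgrp (radical_hull 1))"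
    "\<And>c. c \<in> \<alpha> (arev e) ` carrier (egrp e) \<Longrightarrow> \<chi> c = 1" "\<chi> a \<noteq> 1"
    using separating_character[OF comm_vgrp[OF v] fin_gen_vgrp[OF v] C a] by blast
  obtain \<Phi> where "\<Phi> \<in> hom PI (cgrp (radical_hull 1))"
    "\<And>a. a \<in> carrier (vgrp (head \<Gamma> e)) \<Longrightarrow> \<Phi> (vert_elt (head \<Gamma> e) a) = \<chi> a"
    using extend_character_PI[OF root_closed_radical_hull v \<chi>(1)] by auto
  then show ?thesis using that[of \<Phi>] \<chi> a(1) \<alpha>_arev_closed[OF e] by simp
qed

lemma finite_character_range:
  assumes "\<Phi> \<in> hom PI (cgrp (radical_hull 1))"
  shows "finite (\<Phi> ` carrier PI)"
proof -
  obtain M where "M > 0" "\<And>x. x \<in> carrier PI \<Longrightarrow> \<exists>k::int. \<Phi> x ^ M = 1 powi k"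
    using PI.radical_hull_exponent[OF finitely_generated_PI _ assms] by auto
  then have "\<Phi> ` carrier PI \<subseteq> {z. z ^ M = 1}" "finite {z::complex. z ^ M = 1}" by auto
  then show ?thesis by (rule finite_subset)
qed

lemma virtual_retract_hyperbolic:
  assumes x: "x \<in> carrier PI" and w: "lwalk u w u" "w \<noteq> []" "cyc_reduced w"
    and g: "g = x \<otimes>\<^bsub>PI\<^esub> lval w \<otimes>\<^bsub>PI\<^esub> inv\<^bsub>PI\<^esub> x"
  shows "virtual_retract PI (range (\<lambda>k::int. g [^]\<^bsub>PI\<^esub> k))"
proof -
  define n where "n = length w"
  define ed where "ed i = fst (w ! i)" for i
  define la where "la i = snd (w ! i)" for i
  define el where "el i = vert_elt (head \<Gamma> (ed i)) (la i)" for i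
  have n0: "n > 0" using w(2) by (simp add: n_def)
  have u: "u \<in> verts \<Gamma>" using lwalk_verts[OF w(1)] by simp
  have lw: "fst p \<in> arcs \<Gamma> \<and> snd p \<in> carrier (vgrp (head \<Gamma> (fst p)))"
    if "p \<in> set w" "lwalk u w v" for p w u v
    using that by (induction u w v rule: lwalk.induct) auto
  have arc: "ed i \<in> arcs \<Gamma>" and la: "la i \<in> carrier (vgrp (head \<Gamma> (ed i)))" if "i < n" for i
    using lw[OF nth_mem w(1)] that by (simp_all add: n_def ed_def la_def)
  have el: "el i \<in> carrier PI" if "i < n" for i using arc la that by (simp add: el_def)
  define bt where "bt i \<longleftrightarrow> i < n \<and> ed (Suc i mod n) = arev (ed i)" for i
  have "\<exists>\<Phi>. \<Phi> \<in> hom PI (cgrp (radical_hull 1)) \<and> \<Phi> (el i) \<noteq> 1 \<and>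
      (\<forall>c\<in>carrier (egrp (ed i)). \<Phi> (vert_elt (head \<Gamma> (ed i)) (\<alpha> (arev (ed i)) c)) = 1)" if i: "bt i" for i
  proof -
    have "la i \<notin> \<alpha> (arev (ed i)) ` carrier (egrp (ed i))"
      using w(3) i by (simp add: cyc_reduced_def bt_def ed_def la_def n_def)
    then show ?thesis using edge_separating_character[OF arc la, of i] i unfolding el_def bt_def by metis
  qed
  then obtain \<Phi> where \<Phi>: "\<And>i. bt i \<Longrightarrow> \<Phi> i \<in> hom PI (cgrp (radical_hull 1))"
    "\<And>i. bt i \<Longrightarrow> \<Phi> i (el i) \<noteq> 1"
    "\<And>i c. bt i \<Longrightarrow> c \<in> carrier (egrp (ed i)) \<Longrightarrow> \<Phi> i (vert_elt (head \<Gamma> (ed i)) (\<alpha> (arev (ed i)) c)) = 1"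
    by metis
  interpret rh: root_closed "radical_hull 1" by (rule root_closed_radical_hull) simp
  \<comment> \<open>The product of the chosen characters, with values in functions of the position
    under pointwise multiplication. The default 1 keeps it multiplicative and its image
    \<open>R\<close> finite.\<close>
  define X where "X p = (\<lambda>i. if bt i then \<Phi> i p else 1)" for p
  have X_mult: "X (p \<otimes>\<^bsub>PI\<^esub> q) = X p * X q" if "p \<in> carrier PI" "q \<in> carrier PI" for p q
    using hom_mult[OF \<Phi>(1) that] by (auto simp: X_def fun_eq_iff)
  have X_one: "X \<one>\<^bsub>PI\<^esub> = 1"
    using hom_one[OF \<Phi>(1) PI.group_axioms rh.cgrp.is_group] by (auto simp: X_def fun_eq_iff)
  have X_inv: "X (inv\<^bsub>PI\<^esub> p) * X p = 1" "X p * X (inv\<^bsub>PI\<^esub> p) = 1" if "p \<in> carrier PI" for p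
    using that X_one by (simp_all flip: X_mult)
  define R where "R = X ` carrier PI"
  have R_mult: "r * s \<in> R" if "r \<in> R" "s \<in> R" for r s
    using that unfolding R_def by (auto simp flip: X_mult)
  have finR: "finite R"
  proof -
    let ?V = "insert 1 (\<Union>i\<in>{i. bt i}. \<Phi> i ` carrier PI)"
    have "finite {i. bt i}" by (rule finite_subset[of _ "{..<n}"]) (auto simp: bt_def)
    then have "finite ?V" using finite_character_range \<Phi>(1) by auto
    then have "finite {f. \<forall>i. (i \<in> {..<n} \<longrightarrow> f i \<in> ?V) \<and> (i \<notin> {..<n} \<longrightarrow> f i = 1)}"
      by (intro finite_set_of_finite_funs) auto
    moreover have "X p i \<in> ?V" "\<not> i < n \<Longrightarrow> X p i = 1" if "p \<in> carrier PI" for p i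
      using that by (cases "bt i"; auto simp: X_def bt_def)+
    then have "R \<subseteq> {f. \<forall>i. (i \<in> {..<n} \<longrightarrow> f i \<in> ?V) \<and> (i \<notin> {..<n} \<longrightarrow> f i = 1)}"
      unfolding R_def by auto
    ultimately show ?thesis by (rule finite_subset[rotated])
  qed
  \<comment> \<open>The image of the edge group in \<open>R\<close>. The default \<open>{1}\<close>
    is there because \<open>swap_system\<close> asks for a subgroup at every label.\<close>
  define Dg where "Dg e = (if e \<in> arcs \<Gamma> then (\<lambda>c. X (vert_elt (tail \<Gamma> e) (\<alpha> e c))) ` carrier (egrp e) else {1})" for e
  have DgI: "X (vert_elt (tail \<Gamma> e) (\<alpha> e c)) \<in> Dg e" if "e \<in> arcs \<Gamma>" "c \<in> carrier (egrp e)" for e c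
    using that by (simp add: Dg_def)
  have Dg_arev: "Dg (arev e) = Dg e" if "e \<in> arcs \<Gamma>" for e
    using that vert_elt_edge[OF that] by (simp add: Dg_def egrp_arev)
  have Dg_hom: "group_hom (egrp e) PI (\<lambda>c. vert_elt (tail \<Gamma> e) (\<alpha> e c))" if "e \<in> arcs \<Gamma>" for e
    using hom_compose[OF \<alpha>_hom[OF that] vert_elt_hom] that group_egrp PI.group_axioms
    by (simp add: group_hom_def group_hom_axioms_def comp_def)
  \<comment> \<open>Each letter of the walk takes two levels: \<open>2i\<close> to
    \<open>2i + 1\<close> has label \<open>ed i\<close> and factor 1, and \<open>2i + 1\<close> to
    \<open>2i + 2\<close> has label \<open>arev (ed i)\<close> and the factor of the vertex element.
    One turn of the walk thus fills \<open>N = 2n\<close> levels.\<close>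
  define ix where "ix j = nat ((j div 2) mod int n)" for j :: int
  define \<sigma> where "\<sigma> j = (if even j then ed (ix j) else arev (ed (ix j)))" for j
  define b where "b j = (if even j then 1 else X (el (ix j)))" for j
  define b' where "b' j = (if even j then 1 else X (inv\<^bsub>PI\<^esub> (el (ix j))))" for j
  define N where "N = 2 * int n"
  have ix: "ix j < n" for j using n0 by (simp add: ix_def nat_less_iff)
  have ix_per: "ix (j + m * N) = ix j" for j m
  proof -
    have "(j + m * N) div 2 = j div 2 + m * int n" by (simp add: N_def)
    then show ?thesis by (simp add: ix_def)
  qed
  have even_per: "even (j + m * N) \<longleftrightarrow> even j" for j m by (simp add: N_def)
  have el_ix: "el (ix j) \<in> carrier PI" for j using el ix by simp
  interpret S: swap_system N R b b' \<sigma> Dg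
  proof
    show "b j * b' j = 1" for j using X_inv(2)[OF el_ix] by (simp add: b_def b'_def)
    show "\<sigma> (j + m * N) = \<sigma> j" "b (j + m * N) = b j" "b' (j + m * N) = b' j" for j m
      unfolding \<sigma>_def b_def b'_def ix_per even_per by simp_all
    have "1 \<in> R" using X_one by (metis R_def PI.one_closed imageI)
    then show "b j \<in> R" "b' j \<in> R" for j using el_ix by (auto simp: b_def b'_def R_def)
    show "1 \<in> Dg e" for e
    proof (cases "e \<in> arcs \<Gamma>")
      case True
      interpret h: group_hom "egrp e" PI "\<lambda>c. vert_elt (tail \<Gamma> e) (\<alpha> e c)" by (rule Dg_hom[OF True])
      have "1 = X (vert_elt (tail \<Gamma> e) (\<alpha> e \<one>\<^bsub>egrp e\<^esub>))" using h.hom_one X_one by simp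
      then show ?thesis using DgI[OF True h.G.one_closed] by simp
    qed (simp add: Dg_def)
    show "r * s \<in> Dg e" if rs: "r \<in> Dg e" "s \<in> Dg e" for r s e
    proof (cases "e \<in> arcs \<Gamma>")
      case True
      interpret h: group_hom "egrp e" PI "\<lambda>c. vert_elt (tail \<Gamma> e) (\<alpha> e c)" by (rule Dg_hom[OF True])
      obtain c d where cd: "c \<in> carrier (egrp e)" "d \<in> carrier (egrp e)"
        "r = X (vert_elt (tail \<Gamma> e) (\<alpha> e c))" "s = X (vert_elt (tail \<Gamma> e) (\<alpha> e d))"
        using rs True by (auto simp: Dg_def)
      then have "r * s = X (vert_elt (tail \<Gamma> e) (\<alpha> e (c \<otimes>\<^bsub>egrp e\<^esub> d)))"
        using h.hom_mult h.hom_closed X_mult by metis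
      then show ?thesis using DgI[OF True h.G.m_closed[OF cd(1,2)]] by simp
    qed (use rs in \<open>simp add: Dg_def\<close>)
    show "\<exists>s\<in>Dg e. s * r = 1" if r: "r \<in> Dg e" for r e
    proof (cases "e \<in> arcs \<Gamma>")
      case True
      interpret h: group_hom "egrp e" PI "\<lambda>c. vert_elt (tail \<Gamma> e) (\<alpha> e c)" by (rule Dg_hom[OF True])
      obtain c where c: "c \<in> carrier (egrp e)" "r = X (vert_elt (tail \<Gamma> e) (\<alpha> e c))"
        using r True by (auto simp: Dg_def)
      then have "X (vert_elt (tail \<Gamma> e) (\<alpha> e (inv\<^bsub>egrp e\<^esub> c))) * r = 1"
        using h.hom_inv[OF c(1)] h.hom_closed[OF c(1)] X_inv(1) by simp
      moreover have "X (vert_elt (tail \<Gamma> e) (\<alpha> e (inv\<^bsub>egrp e\<^esub> c))) \<in> Dg e"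
        by (rule DgI[OF True h.G.inv_closed[OF c(1)]])
      ultimately show ?thesis by blast
    qed (use r in \<open>simp add: Dg_def\<close>)
    \<comment> \<open>For even \<open>j\<close> the two labels are an arc and its reverse, hence
      distinct. For odd \<open>j\<close> equal labels mean a backtracking at \<open>ix j\<close>;
      there the coordinate \<open>ix j\<close> is 1 on the edge group but not on
      \<open>b j\<close>.\<close>
    show "b j \<notin> Dg (\<sigma> j)" if "\<sigma> (j + 1) = \<sigma> j" for j
    proof (cases "even j")
      case True
      then have "(j + 1) div 2 = j div 2" by auto
      then have "arev (ed (ix j)) = ed (ix j)" using that True by (simp add: \<sigma>_def ix_def)
      then show ?thesis using arev_neq[OF arc[OF ix]] by blast
    next
      case False
      have "(j + 1) div 2 = j div 2 + 1" using False by presburger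
      then have "int (ix (j + 1)) = int (Suc (ix j) mod n)"
        using n0 by (simp add: ix_def zmod_int mod_add_right_eq add.commute)
      then have "ix (j + 1) = Suc (ix j) mod n" by linarith
      then have B: "bt (ix j)" using that False ix[of j] by (simp add: \<sigma>_def bt_def)
      have "r (ix j) = 1" if r: "r \<in> Dg (\<sigma> j)" for r
      proof -
        note e = arc[OF ix[of j]]
        obtain c where "c \<in> carrier (egrp (ed (ix j)))"
          "r = X (vert_elt (head \<Gamma> (ed (ix j))) (\<alpha> (arev (ed (ix j))) c))"
          using r e False by (auto simp: Dg_def \<sigma>_def egrp_arev)
        then show ?thesis using \<Phi>(3)[OF B] B by (simp add: X_def)
      qed
      moreover have "b j (ix j) \<noteq> 1" using \<Phi>(2)[OF B] B False by (simp add: b_def X_def)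
      ultimately show ?thesis by blast
    qed
  qed (use R_mult in auto)
  let ?L = "periodic_perms N R"
  interpret L: group ?L by (rule group_periodic_perms)
  \<comment> \<open>The group acts by translations through \<open>X\<close> and keeps every level;
    the swaps will make the action mix levels.\<close>
  define \<mu> where "\<mu> p = map_prod ((*) (X p)) (id :: int \<Rightarrow> int)" for p
  have \<mu>_mult: "\<mu> (p \<otimes>\<^bsub>PI\<^esub> q) = \<mu> p \<circ> \<mu> q" if "p \<in> carrier PI" "q \<in> carrier PI" for p q
    using that by (auto simp: \<mu>_def X_mult mult.assoc)
  have \<mu>_one: "\<mu> \<one>\<^bsub>PI\<^esub> = id" by (auto simp: \<mu>_def X_one)
  have \<mu>_L: "\<mu> p \<in> carrier ?L" if p: "p \<in> carrier PI" for p
  proof (rule periodic_permsI)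
    have inv: "\<mu> (inv\<^bsub>PI\<^esub> p) \<circ> \<mu> p = id" "\<mu> p \<circ> \<mu> (inv\<^bsub>PI\<^esub> p) = id"
      using p by (simp_all add: \<mu>_one flip: \<mu>_mult)
    then show "bij (\<mu> p)" by (rule o_bij)
    have R: "\<mu> q z \<in> R \<times> UNIV" if "q \<in> carrier PI" "z \<in> R \<times> UNIV" for q z
      using that R_mult by (auto simp: \<mu>_def R_def)
    show "\<mu> p z \<in> R \<times> UNIV \<longleftrightarrow> z \<in> R \<times> UNIV" for z
      using R[OF p, of z] R[of "inv\<^bsub>PI\<^esub> p" "\<mu> p z"] p inv(1) by (metis PI.inv_closed comp_apply id_apply)
  qed (simp add: \<mu>_def)
  have \<mu>_hom: "\<mu> \<in> hom PI ?L" using \<mu>_L \<mu>_mult by (intro homI) simp_all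
  \<comment> \<open>As a product of the two involutions of \<open>e\<close> and
    \<open>arev e\<close>, its inverse is \<open>t (arev e)\<close>, as the symmetry condition of
    \<open>serre_tree_family\<close> demands.\<close>
  define t where "t e = S.\<tau> e \<circ> S.\<tau> (arev e)" for e
  have t_L: "t e \<in> carrier ?L" for e
    using L.m_closed[OF S.\<tau>_periodic_perms S.\<tau>_periodic_perms] by (simp add: t_def)
  have t_arev: "t e \<circ> t (arev e) = id" for e by (auto simp: t_def S.\<tau>_\<tau>)
  have t_comm: "t e \<circ> \<mu> p = \<mu> p \<circ> t e"
    if e: "e \<in> arcs \<Gamma>" and c: "c \<in> carrier (egrp e)" and p: "p = vert_elt (tail \<Gamma> e) (\<alpha> e c)" for e c p
  proof -
    have "X p \<in> Dg e" "X p \<in> Dg (arev e)" using e c p by (auto simp: Dg_arev) (auto simp: Dg_def)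
    then have \<tau>: "S.\<tau> e (\<mu> p z) = \<mu> p (S.\<tau> e z)" "S.\<tau> (arev e) (\<mu> p z) = \<mu> p (S.\<tau> (arev e) z)" for z
      using S.\<tau>_equivariant by (cases z; simp add: \<mu>_def)+
    show ?thesis by (auto simp: t_def \<tau>)
  qed
  \<comment> \<open>\<open>s v\<close> is the product of the \<open>t e\<close> along a path from
    \<open>u\<close> to \<open>v\<close>, so the action at \<open>v\<close> will be
    \<open>\<mu>\<close> conjugated by \<open>s v\<close>.\<close>
  obtain s where su: "s u = id" and s_L: "\<And>v. v \<in> verts \<Gamma> \<Longrightarrow> s v \<in> carrier ?L"
    and s_arc: "\<And>e. e \<in> arcs \<Gamma> \<Longrightarrow> s (head \<Gamma> e) = s (tail \<Gamma> e) \<circ> t e"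
  proof (rule serre_tree_family[OF tree finite_verts u,
        where Q = "\<lambda>v f. f \<in> carrier ?L" and R = "\<lambda>e f f'. f' = f \<circ> t e" and x\<^sub>0 = id])
    show "id \<in> carrier ?L" using L.one_closed by simp
    show "f = f' \<circ> t (arev e)" if "f' = f \<circ> t e" for e f f'
      using that t_arev[of e] by (simp add: comp_assoc)
    show "\<exists>f'. f' \<in> carrier ?L \<and> f' = f \<circ> t e" if "f \<in> carrier ?L" for e f
      using L.m_closed[OF that t_L] by simp
  qed blast
  define \<phi> where "\<phi> v = (\<lambda>f. s v \<otimes>\<^bsub>?L\<^esub> f \<otimes>\<^bsub>?L\<^esub> inv\<^bsub>?L\<^esub> s v) \<circ> \<mu> \<circ> vert_elt v" for v
  have \<phi>_hom: "\<phi> v \<in> hom (vgrp v) ?L" if "v \<in> verts \<Gamma>" for v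
    unfolding \<phi>_def comp_assoc
    by (rule hom_compose[OF hom_compose[OF vert_elt_hom[OF that] \<mu>_hom] L.conjugation_hom[OF s_L[OF that]]])
  have "\<phi> (tail \<Gamma> e) (\<alpha> e c) = \<phi> (head \<Gamma> e) (\<alpha> (arev e) c)"
    if e: "e \<in> arcs \<Gamma>" and c: "c \<in> carrier (egrp e)" for e c
  proof -
    let ?p = "vert_elt (tail \<Gamma> e) (\<alpha> e c)" and ?s = "s (tail \<Gamma> e)"
    have p: "?p \<in> carrier PI" using e c \<alpha>_closed by simp
    have m: "\<mu> ?p \<in> carrier ?L" "?s \<in> carrier ?L" using \<mu>_L[OF p] s_L e by auto
    \<comment> \<open>\<open>t e\<close> centralizes the edge group, so conjugating by
      \<open>s\<close> of the tail or by \<open>s\<close> of the head has the same effect on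
      it.\<close>
    have "t e \<otimes>\<^bsub>?L\<^esub> \<mu> ?p \<otimes>\<^bsub>?L\<^esub> inv\<^bsub>?L\<^esub> t e = \<mu> ?p \<otimes>\<^bsub>?L\<^esub> t e \<otimes>\<^bsub>?L\<^esub> inv\<^bsub>?L\<^esub> t e"
      using t_comm[OF e c HOL.refl] by simp
    also have "\<dots> = \<mu> ?p" using m t_L by (simp only: L.m_assoc L.r_inv L.inv_closed L.r_one)
    finally have conj: "t e \<otimes>\<^bsub>?L\<^esub> \<mu> ?p \<otimes>\<^bsub>?L\<^esub> inv\<^bsub>?L\<^esub> t e = \<mu> ?p" .
    have "\<phi> (head \<Gamma> e) (\<alpha> (arev e) c) =
        (?s \<otimes>\<^bsub>?L\<^esub> t e) \<otimes>\<^bsub>?L\<^esub> \<mu> ?p \<otimes>\<^bsub>?L\<^esub> inv\<^bsub>?L\<^esub> (?s \<otimes>\<^bsub>?L\<^esub> t e)"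
      using vert_elt_edge[OF e c] s_arc[OF e] by (simp add: \<phi>_def)
    also have "\<dots> = ?s \<otimes>\<^bsub>?L\<^esub> (t e \<otimes>\<^bsub>?L\<^esub> \<mu> ?p \<otimes>\<^bsub>?L\<^esub> inv\<^bsub>?L\<^esub> t e) \<otimes>\<^bsub>?L\<^esub> inv\<^bsub>?L\<^esub> ?s"
      using m t_L by (simp only: L.m_assoc L.inv_mult_group L.m_closed L.inv_closed)
    also have "\<dots> = \<phi> (tail \<Gamma> e) (\<alpha> e c)" by (simp only: conj \<phi>_def comp_apply)
    finally show ?thesis by simp
  qed
  then obtain \<Psi> where \<Psi>: "\<Psi> \<in> hom PI ?L"
    "\<And>v a. v \<in> verts \<Gamma> \<Longrightarrow> a \<in> carrier (vgrp v) \<Longrightarrow> \<Psi> (vert_elt v a) = \<phi> v a"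
    using PI_hom[OF L.is_group \<phi>_hom] by blast
  have \<Psi>_mult: "\<Psi> (p \<otimes>\<^bsub>PI\<^esub> q) = \<Psi> p \<circ> \<Psi> q" if "p \<in> carrier PI" "q \<in> carrier PI" for p q
    using hom_mult[OF \<Psi>(1) that] by simp
  have \<Psi>_one: "\<Psi> \<one>\<^bsub>PI\<^esub> = id" using hom_one[OF \<Psi>(1) PI.group_axioms L.is_group] by simp
  have \<Psi>_L: "\<Psi> p \<in> carrier ?L" if "p \<in> carrier PI" for p using hom_in_carrier[OF \<Psi>(1) that] .
  \<comment> \<open>One letter descends two levels: the conjugators at both ends of the arc differ
    by \<open>t\<close>, whose two involutions each contribute one
    \<open>\<tau>_step\<close>.\<close>
  have letter: "\<Psi> (el i) (s (head \<Gamma> (ed i)) (1, 2 * int i + 2)) = s (tail \<Gamma> (ed i)) (1, 2 * int i)"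
    if i: "i < n" for i
  proof -
    let ?s = "s (head \<Gamma> (ed i))"
    note e = arc[OF i]
    have s: "?s \<in> carrier ?L" using s_L e by simp
    have ix2: "ix (2 * int i + 1) = i" "ix (2 * int i) = i" using i by (simp_all add: ix_def)
    have "\<Psi> (el i) = ?s \<circ> \<mu> (el i) \<circ> inv_into UNIV ?s"
      using \<Psi>(2)[of "head \<Gamma> (ed i)" "la i"] la[OF i] e periodic_perms_inv[OF s]
      by (simp add: \<phi>_def el_def)
    then have "\<Psi> (el i) (?s (1, 2 * int i + 2)) = ?s (X (el i), 2 * int i + 2)"
      using periodic_permsD(1)[OF s] by (simp add: \<mu>_def bij_is_inj)
    also have "\<dots> = s (tail \<Gamma> (ed i)) (S.\<tau> (ed i) (S.\<tau> (arev (ed i)) (X (el i), 2 * int i + 2)))"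
      using s_arc[OF e] by (simp add: t_def)
    also have "S.\<tau> (arev (ed i)) (X (el i), 2 * int i + 2) = (1, 2 * int i + 1)"
      using S.\<tau>_step[of "2 * int i + 1"] ix2 by (simp add: \<sigma>_def b_def add.assoc)
    also have "S.\<tau> (ed i) (1, 2 * int i + 1) = (1, 2 * int i)"
      using S.\<tau>_step[of "2 * int i"] ix2 by (simp add: \<sigma>_def b_def)
    finally show ?thesis .
  qed
  \<comment> \<open>Letters act from the right end, hence the induction over suffixes, beginning at
    level \<open>N\<close> with the empty one.\<close>
  have walk: "\<Psi> (lval (drop k w)) (s u (1, N)) = s v (1, 2 * int k)"
    if "k \<le> n" "lwalk v (drop k w) u" for k v
    using that
  proof (induction k arbitrary: v rule: inc_induct)
    case base
    then show ?case using \<Psi>_one by (simp add: n_def N_def)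
  next
    case (step k)
    have dk: "drop k w = (ed k, la k) # drop (Suc k) w"
      using step by (simp add: Cons_nth_drop_Suc n_def ed_def la_def)
    have v: "tail \<Gamma> (ed k) = v" "lwalk (head \<Gamma> (ed k)) (drop (Suc k) w) u"
      using step.prems by (simp_all add: dk)
    have "\<Psi> (lval (drop k w)) = \<Psi> (el k) \<circ> \<Psi> (lval (drop (Suc k) w))"
      using \<Psi>_mult[OF el[OF \<open>k < n\<close>] lval_closed[OF v(2)]] by (simp add: dk el_def)
    moreover have two: "2 * int (Suc k) = 2 * int k + 2" by simp
    ultimately have "\<Psi> (lval (drop k w)) (s u (1, N)) = \<Psi> (el k) (s (head \<Gamma> (ed k)) (1, 2 * int k + 2))"
      using step.IH[OF v(2)] two by (simp only: comp_apply)
    then show ?case using letter[OF \<open>k < n\<close>] v by (simp only:)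
  qed
  let ?y\<^sub>0 = "(1, 0) :: (nat \<Rightarrow> complex) \<times> int"
  define S where "S m = map_prod (id :: (nat \<Rightarrow> complex) \<Rightarrow> _) (\<lambda>i. i + m * N)" for m
  have per: "\<Psi> p (S m z) = S m (\<Psi> p z)" if "p \<in> carrier PI" for p m z
    using periodic_permsD(2)[OF \<Psi>_L[OF that]] by (cases z) (simp add: S_def)
  have lvc: "lval w \<in> carrier PI" using lval_closed[OF w(1)] .
  \<comment> \<open>The complete walk descends from level \<open>N\<close> to level 0. Periodicity
    turns this into a shift of the level-0 point by -1 period.\<close>
  have "\<Psi> (lval w) (S 1 ?y\<^sub>0) = ?y\<^sub>0" using walk[of 0 u] w(1) su by (simp add: S_def)
  then have "\<Psi> (lval w) (S (- 1) (S 1 ?y\<^sub>0)) = S (- 1) ?y\<^sub>0" using per[OF lvc] by simp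
  then have lv: "\<Psi> (lval w) ?y\<^sub>0 = S (- 1) ?y\<^sub>0" by (simp add: S_def)
  have gc: "g \<in> carrier PI" using g x lvc by simp
  have xinv: "\<Psi> (inv\<^bsub>PI\<^esub> x) (\<Psi> x z) = z" for z
    using \<Psi>_mult[of "inv\<^bsub>PI\<^esub> x" x] x \<Psi>_one by (metis PI.inv_closed PI.l_inv comp_apply id_apply)
  \<comment> \<open>Moving the base point by \<open>x\<close> undoes the conjugation in
    \<open>g\<close>.\<close>
  have "\<Psi> g (\<Psi> x ?y\<^sub>0) = \<Psi> x (\<Psi> (lval w) ?y\<^sub>0)"
    using g x lvc by (simp add: \<Psi>_mult xinv)
  then have gy: "\<Psi> g (\<Psi> x ?y\<^sub>0) = S (- 1) (\<Psi> x ?y\<^sub>0)" using lv per[OF x] by simp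
  have N0: "N > 0" using n0 by (simp add: N_def)
  show ?thesis
  proof (rule PI.virtual_retract_of_action[where \<Phi> = \<Psi> and S = S and y = "\<Psi> x ?y\<^sub>0"
        and q = "map_prod id (\<lambda>i. i mod N)" and F = "R \<times> {0..<N}"])
    show "S m p = S k p \<Longrightarrow> m = k" for m k p using N0 by (cases p) (simp add: S_def)
    show "S (m + k) p = S m (S k p)" for m k p by (cases p) (simp add: S_def algebra_simps)
    show "map_prod id (\<lambda>i. i mod N) (\<Psi> p (\<Psi> x ?y\<^sub>0)) \<in> R \<times> {0..<N}" if "p \<in> carrier PI" for p
    proof -
      have "1 \<in> R" using X_one by (metis R_def PI.one_closed imageI)
      then have "\<Psi> p (\<Psi> x ?y\<^sub>0) \<in> R \<times> UNIV"
        using periodic_permsD(3)[OF \<Psi>_L[OF that]] periodic_permsD(3)[OF \<Psi>_L[OF x]] by simp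
      then show ?thesis using N0 by (cases "\<Psi> p (\<Psi> x ?y\<^sub>0)") auto
    qed
    show "\<exists>m. p = S m p'" if pp: "map_prod id (\<lambda>i. i mod N) p = map_prod id (\<lambda>i. i mod N) p'"
      for p p' :: "(nat \<Rightarrow> complex) \<times> int"
    proof -
      obtain r i j where p: "p = (r, i)" "p' = (r, j)" "i mod N = j mod N"
        using pp by (cases p; cases p') auto
      then obtain m where "i - j = N * m" by (metis mod_eq_dvd_iff dvdE)
      then have "p = S m p'" using p by (simp add: S_def algebra_simps)
      then show ?thesis ..
    qed
  qed (use \<Psi>_one \<Psi>_mult per gc gy finR in \<open>auto simp: S_def\<close>)
qed

section \<open>Cyclic subgroups of the fundamental group\<close>

lemma has_VRC_PI: "has_VRC PI"
  unfolding has_VRC_def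
proof (intro allI impI)
  fix H assume H: "subgroup H PI \<and> cyclic_group (PI\<lparr>carrier := H\<rparr>)"
  interpret H: group "PI\<lparr>carrier := H\<rparr>" using H PI.subgroup_imp_group by blast
  obtain g where g: "g \<in> H" "H = range (\<lambda>k::int. g [^]\<^bsub>PI\<lparr>carrier := H\<rparr>\<^esub> k)"
    using H H.cyclic_group by auto
  have Hg: "H = range (\<lambda>k::int. g [^]\<^bsub>PI\<^esub> k)"
    using g H PI.int_pow_consistent[of H g] by simp
  have "g \<in> carrier PI" using g(1) H subgroup.subset by blast
  then show "virtual_retract PI H" unfolding Hg
  proof (cases g rule: conjugate_cases)
    case (elliptic x v a)
    then show "virtual_retract PI (range (\<lambda>k::int. g [^]\<^bsub>PI\<^esub> k))"
      using virtual_retract_elliptic by blast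
  next
    case (hyperbolic x u w)
    then show "virtual_retract PI (range (\<lambda>k::int. g [^]\<^bsub>PI\<^esub> k))"
      using virtual_retract_hyperbolic by blast
  qed
qed

end

theorem theorem7p5:
  fixes \<Gamma> :: "('v, 'e) pre_digraph" and arev :: "'e \<Rightarrow> 'e"
    and vgrp :: "'v \<Rightarrow> 'g monoid" and egrp :: "'e \<Rightarrow> 'h monoid" and \<alpha> :: "'e \<Rightarrow> 'h \<Rightarrow> 'g"
    and T :: "('v, 'e) pre_digraph" and P :: "'e set"
  assumes "finite_graph_of_groups \<Gamma> arev vgrp egrp \<alpha>"
    and "serre_tree \<Gamma> arev"
    and "\<And>v. v \<in> verts \<Gamma> \<Longrightarrow> comm_group (vgrp v)"
    and "\<And>v. v \<in> verts \<Gamma> \<Longrightarrow> finitely_generated_group (vgrp v)"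
    and "maximal_tree \<Gamma> arev T"
    and "orientation \<Gamma> arev P"
  shows "has_VRC (fundamental_group \<Gamma> arev vgrp egrp \<alpha> T P)"
proof -
  interpret finite_graph_of_groups \<Gamma> arev vgrp egrp \<alpha> by fact
  interpret abelian_tree \<Gamma> arev vgrp egrp \<alpha> P
    by (intro abelian_tree.intro abelian_tree_axioms.intro assms)
  have "subgraph \<Gamma> \<Gamma>" by (auto simp: subgraph_def compatible_def wf_digraph)
  \<comment> \<open>\<open>\<Gamma>\<close> is a Serre tree containing \<open>T\<close>, so
    maximality leaves no room between them.\<close>
  then have "T = \<Gamma>"
    using assms(2,5) unfolding maximal_tree_def max_subgraph_def by metis
  then show ?thesis using has_VRC_PI by simp
qed

end
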